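(* Let $L$ be an abelian extension of a number field $K$ with $L=K(x,y)$ for some algebraic integers $x,y$. Let $\ell=[L:K(x)]$ and let $a,b,c,d$ be nonzero integers with $2<|a/b|$ and $2<|c/d|$. Then for all nonzero integers $n,m$, \[L=K\big((ax+b)^n(cy+d)^{-m\ell}\,\mathrm{N}_{L/K(x)}((cy+d)^m)\big).\] *)

theory Defs
  imports
    "HOL-Algebra.Algebraic_Closure_Type"
    "HOL-Algebra.Generated_Fields"
    "HOL-Algebra.Bij"
    "Jordan_Normal_Form.Determinant"
begin

text \<open>
  All fields are subfields of a fixed but arbitrary ambient field, given by a type of class
  \<^class>\<open>field\<close>. The record \<open>amb\<close> presents that type as a structure in the sense
  of HOL-Algebra, which supplies subfields, generated subfields, algebraicity, bases and degrees.
\<close>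

abbreviation amb :: "'a::field ring"
  where "amb \<equiv> ring_of_type_algebra"

text \<open>In characteristic 0 the prime field of the ambient field is \<open>\<rat>\<close>.\<close>

definition number_field :: "'a::field_char_0 set \<Rightarrow> bool"
  where "number_field K \<longleftrightarrow> subfield K amb \<and> ring.finite_dimension amb \<rat> K"

definition adjoin :: "'a::field set \<Rightarrow> 'a set \<Rightarrow> 'a set"
  where "adjoin K S = generate_field amb (K \<union> S)"

definition degree_ext :: "'a::field set \<Rightarrow> 'a set \<Rightarrow> nat"
  where "degree_ext L F = ring.dim amb F L"

text \<open>
  The group of automorphisms of \<open>L\<close> over \<open>K\<close>. Being elements of \<^term>\<open>Bij L\<close>, the
  automorphisms are extensional functions, so each is represented by exactly one function.
\<close>

definition gal_group :: "'a::field set \<Rightarrow> 'a set \<Rightarrow> ('a \<Rightarrow> 'a) monoid"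
  where "gal_group L K = (BijGroup L)
    \<lparr>carrier := {\<sigma> \<in> Bij L. \<sigma> \<in> Ring.ring_hom (amb\<lparr>carrier := L\<rparr>) (amb\<lparr>carrier := L\<rparr>)
                           \<and> (\<forall>k\<in>K. \<sigma> k = k)}\<rparr>"

text \<open>
  An extension is Galois if it is algebraic and the fixed field of its automorphism group
  is the base field.
\<close>

definition galois_extension :: "'a::field set \<Rightarrow> 'a set \<Rightarrow> bool"
  where "galois_extension L K \<longleftrightarrow>
    subfield K amb \<and> subfield L amb \<and> K \<subseteq> L \<and>
    (\<forall>z\<in>L. (ring.algebraic amb over K) z) \<and>
    {z \<in> L. \<forall>\<sigma>\<in>carrier (gal_group L K). \<sigma> z = z} = K"

definition abelian_extension :: "'a::field set \<Rightarrow> 'a set \<Rightarrow> bool"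
  where "abelian_extension L K \<longleftrightarrow> galois_extension L K \<and> comm_group (gal_group L K)"

definition basis_over :: "'a::field set \<Rightarrow> 'a set \<Rightarrow> 'a list \<Rightarrow> bool"
  where "basis_over F L vs \<longleftrightarrow> ring.independent amb F vs \<and> ring.Span amb F vs = L"

text \<open>
  \<open>mult_matrix F vs z A\<close>: the matrix of multiplication by \<open>z\<close> in the \<open>F\<close>-basis \<open>vs\<close> is \<open>A\<close>,
  column \<open>j\<close> holding the coordinates of \<open>z * vs ! j\<close>.
\<close>

definition mult_matrix :: "'a::field set \<Rightarrow> 'a list \<Rightarrow> 'a \<Rightarrow> 'a mat \<Rightarrow> bool"
  where "mult_matrix F vs z A \<longleftrightarrow>
    A \<in> carrier_mat (length vs) (length vs) \<and> elements_mat A \<subseteq> F \<and>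
    (\<forall>j < length vs. z * vs ! j = (\<Sum>i < length vs. A $$ (i, j) * vs ! i))"

text \<open>
  The norm of a finite extension \<open>L\<close> of \<open>F\<close>: the determinant of multiplication by \<open>z\<close> on the
  \<open>F\<close>-vector space \<open>L\<close>, which does not depend on the basis.
\<close>

definition field_norm :: "'a::field set \<Rightarrow> 'a set \<Rightarrow> 'a \<Rightarrow> 'a"
  where "field_norm L F z =
    (THE d. \<exists>vs A. basis_over F L vs \<and> mult_matrix F vs z A \<and> d = det A)"

end

theory Submission
  imports Defs "Jordan_Normal_Form.Char_Poly"
begin

text \<open>
  Write \<open>u = a x + b\<close>, \<open>v = c y + d\<close>, \<open>F = K(x)\<close>, and let \<open>w\<close> be the proposed generator. The
  exponent \<open>- m l\<close> is chosen so that the norm from \<open>L\<close> to \<open>F\<close> kills the product of the last two factors: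
  \<open>N w = u\<^sup>n\<^sup>l\<close>. Since the Galois group is abelian, norms commute with its elements, so an
  automorphism \<open>\<sigma>\<close> fixing \<open>w\<close> fixes a power of \<open>u\<close>, that is, \<open>\<sigma> u = \<zeta> u\<close> for a root of unity \<open>\<zeta>\<close>.
  Then \<open>(b / a) (\<zeta> - 1) = \<sigma> x - \<zeta> x\<close> is an algebraic integer all of whose conjugates have absolute
  value at most \<open>2 \<bar>b / a\<bar> < 1\<close>, which forces \<open>\<zeta> = 1\<close> and \<open>\<sigma> x = x\<close>. Now \<open>\<sigma>\<close> fixes \<open>F\<close>
  pointwise, hence also a power of \<open>v\<close>, and the same argument gives \<open>\<sigma> y = y\<close>. Finally an element of
  \<open>L\<close> whose stabilizer contains that of \<open>w\<close> lies in \<open>K(w)\<close>, by Lagrange interpolation on the orbit of \<open>w\<close>.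
\<close>

section \<open>Algebraic integers\<close>

text \<open>The determinant trick: the vector of the \<open>v i\<close>, nonzero because of
  \<open>i0\<close>, is an eigenvector of an integer matrix with eigenvalue \<open>g\<close>. The
  characteristic polynomial of that matrix is monic with integer coefficients.\<close>

lemma algebraic_int_if_span_nat:
  fixes v :: "nat \<Rightarrow> 'a::field_char_0"
  assumes "i0 < n" "v i0 \<noteq> 0"
    and stable: "\<And>i. i < n \<Longrightarrow> \<exists>c::nat \<Rightarrow> int. g * v i = (\<Sum>j<n. of_int (c j) * v j)"
  shows "algebraic_int g"
proof -
  have "\<exists>C::nat \<Rightarrow> nat \<Rightarrow> int. \<forall>i<n. g * v i = (\<Sum>j<n. of_int (C i j) * v j)"
    using stable by meson
  then obtain C :: "nat \<Rightarrow> nat \<Rightarrow> int"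
    where C: "\<And>i. i < n \<Longrightarrow> g * v i = (\<Sum>j<n. of_int (C i j) * v j)"
    by blast
  define A where "A = mat n n (\<lambda>(i, j). C i j)"
  have A: "A \<in> carrier_mat n n" by (simp add: A_def)
  let ?A = "map_mat (of_int :: int \<Rightarrow> 'a) A"
  have A': "?A \<in> carrier_mat n n" using A by simp
  have "?A *\<^sub>v vec n v = g \<cdot>\<^sub>v vec n v"
  proof (rule eq_vecI)
    fix i assume "i < dim_vec (g \<cdot>\<^sub>v vec n v)"
    hence i: "i < n" by simp
    thus "(?A *\<^sub>v vec n v) $ i = (g \<cdot>\<^sub>v vec n v) $ i"
      using C[OF i] by (simp add: A_def scalar_prod_def atLeast0LessThan)
  qed (simp add: A_def)
  moreover have "vec n v \<noteq> 0\<^sub>v n"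
  proof
    assume "vec n v = 0\<^sub>v n"
    hence "vec n v $ i0 = 0\<^sub>v n $ i0" by simp
    thus False using assms(1,2) by simp
  qed
  ultimately have "eigenvalue ?A g"
    unfolding eigenvalue_def eigenvector_def using A by (intro exI[of _ "vec n v"]) auto
  hence "poly (char_poly ?A) g = 0" using eigenvalue_root_char_poly[OF A'] by simp
  hence "poly (map_poly of_int (char_poly A)) g = 0"
    by (simp add: of_int_hom.char_poly_hom[OF A])
  thus ?thesis
    unfolding algebraic_int_altdef_ipoly using degree_monic_char_poly[OF A]
    by (intro exI[of _ "char_poly A"]) simp
qed

text \<open>Enumerating \<open>I\<close> reduces this to natural number indices. The application
  below indexes generators by pairs of exponents.\<close>

lemma algebraic_int_if_span:
  fixes v :: "'i \<Rightarrow> 'a::field_char_0"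
  assumes "finite I" "i0 \<in> I" "v i0 \<noteq> 0"
    and stable: "\<And>i. i \<in> I \<Longrightarrow> \<exists>c::'i \<Rightarrow> int. g * v i = (\<Sum>j\<in>I. of_int (c j) * v j)"
  shows "algebraic_int g"
proof -
  obtain h where h: "bij_betw h {..<card I} I"
    using ex_bij_betw_nat_finite[OF \<open>finite I\<close>] by (auto simp: atLeast0LessThan)
  have "i0 \<in> h ` {..<card I}"
    using bij_betw_imp_surj_on[OF h] \<open>i0 \<in> I\<close> by simp
  then obtain k where k: "k < card I" "i0 = h k" by (elim imageE) simp
  show ?thesis
  proof (rule algebraic_int_if_span_nat[of k "card I" "v \<circ> h"])
    fix i assume "i < card I"
    hence "h i \<in> I" using bij_betwE[OF h] by blast
    then obtain c :: "'i \<Rightarrow> int" where "g * v (h i) = (\<Sum>j\<in>I. of_int (c j) * v j)"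
      using stable by blast
    also have "\<dots> = (\<Sum>j<card I. of_int (c (h j)) * v (h j))"
      using sum.reindex_bij_betw[OF h, of "\<lambda>j. of_int (c j) * v j"] by simp
    finally show "\<exists>c::nat \<Rightarrow> int. g * (v \<circ> h) i = (\<Sum>j<card I. of_int (c j) * (v \<circ> h) j)"
      by (intro exI[of _ "c \<circ> h"]) simp
  qed (use k assms in auto)
qed

lemma algebraic_int_power_expansion:
  fixes x :: "'a::field_char_0"
  assumes "algebraic_int x"
  obtains n and c :: "nat \<Rightarrow> int" where "n > 0" "x ^ n = (\<Sum>i<n. of_int (c i) * x ^ i)"
proof -
  obtain p :: "int poly" where p: "poly (map_poly of_int p) x = 0" "lead_coeff p = 1"
    using assms unfolding algebraic_int_altdef_ipoly by blast
  \<comment> \<open>A monic constant is 1 and has no root.\<close>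
  have deg: "degree p > 0"
  proof (rule ccontr)
    assume "\<not> degree p > 0"
    then obtain k where "p = [:k:]" using degree_eq_zeroE by blast
    thus False using p by simp
  qed
  have "(\<Sum>i\<le>degree p. of_int (coeff p i) * x ^ i) = 0"
    using p(1) by (simp add: poly_altdef)
  hence "x ^ degree p + (\<Sum>i<degree p. of_int (coeff p i) * x ^ i) = 0"
    using p(2) by (simp add: lessThan_Suc_atMost[symmetric] add.commute)
  hence "x ^ degree p = (\<Sum>i<degree p. of_int (- coeff p i) * x ^ i)"
    by (simp add: sum_negf eq_neg_iff_add_eq_0)
  thus thesis by (rule that[OF deg])
qed

text \<open>The ring generated by \<open>x\<close> and \<open>y\<close> over the integers is spanned
  by finitely many monomials and is stable under multiplication by \<open>x + y\<close> and by
  \<open>x * y\<close>, so the determinant trick applies to both.\<close>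

lemma algebraic_int_plus_times:
  fixes x y :: "'a::field_char_0"
  assumes "algebraic_int x" "algebraic_int y"
  shows "algebraic_int (x + y)" "algebraic_int (x * y)"
proof -
  obtain p and c :: "nat \<Rightarrow> int" where p: "p > 0" "x ^ p = (\<Sum>i<p. of_int (c i) * x ^ i)"
    using algebraic_int_power_expansion[OF assms(1)] .
  obtain q and d :: "nat \<Rightarrow> int" where q: "q > 0" "y ^ q = (\<Sum>i<q. of_int (d i) * y ^ i)"
    using algebraic_int_power_expansion[OF assms(2)] .
  define I where "I = {..<p} \<times> {..<q}"
  define v where "v = (\<lambda>(i, j). x ^ i * y ^ j)"
  \<comment> \<open>\<open>S\<close> is the additive group spanned by the monomials whose exponents
    stay below the degrees of the two monic relations.\<close>
  define S where "S = range (\<lambda>c::nat \<times> nat \<Rightarrow> int. \<Sum>k\<in>I. of_int (c k) * v k)"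
  have fin: "finite I" by (simp add: I_def)
  have S_add: "s + t \<in> S" if st: "s \<in> S" "t \<in> S" for s t
  proof -
    obtain e f :: "nat \<times> nat \<Rightarrow> int" where "s = (\<Sum>k\<in>I. of_int (e k) * v k)" "t = (\<Sum>k\<in>I. of_int (f k) * v k)"
      using st by (auto simp: S_def)
    hence "s + t = (\<Sum>k\<in>I. of_int (e k + f k) * v k)"
      by (simp add: algebra_simps sum.distrib)
    thus ?thesis unfolding S_def by (intro image_eqI[of _ _ "\<lambda>k. e k + f k"]) auto
  qed
  have S_smult: "of_int z * s \<in> S" if s: "s \<in> S" for s z
  proof -
    obtain e :: "nat \<times> nat \<Rightarrow> int" where "s = (\<Sum>k\<in>I. of_int (e k) * v k)"
      using s by (auto simp: S_def)
    hence "of_int z * s = (\<Sum>k\<in>I. of_int (z * e k) * v k)"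
      by (simp add: sum_distrib_left mult.assoc)
    thus ?thesis unfolding S_def by (intro image_eqI[of _ _ "\<lambda>k. z * e k"]) auto
  qed
  have S_0: "0 \<in> S" unfolding S_def by (rule image_eqI[of _ _ "\<lambda>_. 0"]) auto
  have S_sum: "(\<Sum>k\<in>J. f k) \<in> S" if "\<And>k. k \<in> J \<Longrightarrow> f k \<in> S" for f and J :: "'b set"
    using that by (induction J rule: infinite_finite_induct) (auto intro: S_0 S_add)
  have S_gen: "v k \<in> S" if "k \<in> I" for k
  proof -
    have "v k = (\<Sum>j\<in>I. if j = k then v j else 0)" using that fin by (simp add: sum.delta)
    also have "\<dots> = (\<Sum>j\<in>I. of_int (if j = k then 1 else 0) * v j)" by (intro sum.cong) auto
    finally show ?thesis unfolding S_def by (intro image_eqI[of _ _ "\<lambda>j. if j = k then 1 else 0"]) auto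
  qed
  \<comment> \<open>Multiplication by \<open>x\<close> or \<open>y\<close> leaves the box of
    exponents only at its edge, where the monic relation rewrites the top power.\<close>
  have S_top: "x ^ p * y ^ j \<in> S" if "j < q" for j
    unfolding p(2) sum_distrib_right mult.assoc
    by (intro S_sum S_smult) (use that S_gen[of "(i, j)" for i] in \<open>auto simp: v_def I_def\<close>)
  have S_right: "x ^ i * y ^ q \<in> S" if "i < p" for i
    unfolding q(2) sum_distrib_left mult.left_commute[of "x ^ i"]
    by (intro S_sum S_smult) (use that S_gen[of "(i, j)" for j] in \<open>auto simp: v_def I_def\<close>)
  have xv: "x * v k \<in> S" if kI: "k \<in> I" for k
  proof -
    obtain i j where k: "k = (i, j)" "i < p" "j < q" using kI by (auto simp: I_def)
    have *: "x * v k = x ^ Suc i * y ^ j" by (simp add: k v_def)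
    show ?thesis
    proof (cases "Suc i = p")
      case True
      thus ?thesis using S_top[OF k(3)] unfolding * by simp
    next
      case False
      hence "(Suc i, j) \<in> I" using k by (simp add: I_def)
      from S_gen[OF this] show ?thesis unfolding * by (simp only: v_def prod.case)
    qed
  qed
  have yv: "y * v k \<in> S" if kI: "k \<in> I" for k
  proof -
    obtain i j where k: "k = (i, j)" "i < p" "j < q" using kI by (auto simp: I_def)
    have *: "y * v k = x ^ i * y ^ Suc j" by (simp add: k v_def)
    show ?thesis
    proof (cases "Suc j = q")
      case True
      thus ?thesis using S_right[OF k(2)] unfolding * by simp
    next
      case False
      hence "(i, Suc j) \<in> I" using k by (simp add: I_def)
      from S_gen[OF this] show ?thesis unfolding * by (simp only: v_def prod.case)
    qed
  qed
  \<comment> \<open>Needed for the product: \<open>y * v k\<close> is an element of \<open>S\<close>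
    that need not be a single generator, and \<open>x\<close> is applied to it.\<close>
  have xS: "x * s \<in> S" if s: "s \<in> S" for s
  proof -
    obtain e :: "nat \<times> nat \<Rightarrow> int" where "s = (\<Sum>k\<in>I. of_int (e k) * v k)"
      using s by (auto simp: S_def)
    hence "x * s = (\<Sum>k\<in>I. of_int (e k) * (x * v k))"
      by (simp add: sum_distrib_left mult.left_commute)
    also have "\<dots> \<in> S" by (intro S_sum S_smult xv)
    finally show ?thesis .
  qed
  have alg: "algebraic_int g" if g: "\<And>k. k \<in> I \<Longrightarrow> g * v k \<in> S" for g
  proof (rule algebraic_int_if_span[OF fin])
    show "(0, 0) \<in> I" using p(1) q(1) by (simp add: I_def)
    show "v (0, 0) \<noteq> 0" by (simp add: v_def)
    show "\<exists>c. g * v k = (\<Sum>j\<in>I. of_int (c j) * v j)" if "k \<in> I" for k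
      using g[OF that] unfolding S_def by blast
  qed
  show "algebraic_int (x + y)"
    by (rule alg) (simp only: distrib_right S_add xv yv)
  show "algebraic_int (x * y)"
    by (rule alg) (simp only: mult.assoc xS yv)
qed

lemma algebraic_int_prod_mset:
  fixes f :: "'b \<Rightarrow> 'a::field_char_0"
  assumes "\<And>z. z \<in># M \<Longrightarrow> algebraic_int (f z)"
  shows "algebraic_int (\<Prod>z\<in>#M. f z)"
  using assms by (induction M) (auto intro: algebraic_int_plus_times)

section \<open>Roots of unity and the size of conjugates\<close>

lemma algebraic_int_root_of_unity:
  fixes z :: "'a::field_char_0"
  assumes "z ^ N = 1" "N > 0"
  shows "algebraic_int z"
proof (rule algebraic_int.intros)
  let ?p = "monom 1 N - 1 :: 'a poly"
  have d: "degree ?p = N"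
    using assms(2) degree_add_eq_left[of "-1" "monom 1 N :: 'a poly"] by (simp add: degree_monom_eq)
  show "lead_coeff ?p = 1" using assms(2) unfolding d by simp
  show "\<forall>i. coeff ?p i \<in> \<int>" by simp
  show "poly ?p z = 0" using assms(1) by (simp add: poly_monom)
qed

interpretation map_of_rat_hom: map_poly_idom_hom "of_rat :: rat \<Rightarrow> 'a::field_char_0" ..

text \<open>If the number were integral, so would be its conjugates \<open>b / a * (t - 1)\<close>,
  with \<open>t\<close> ranging over roots of unity other than 1. Each has absolute value at most
  \<open>2 * |b / a|\<close>, which is below 1, so their product would be a nonzero rational integer
  of absolute value below 1. Polynomials over the rationals carry the argument from the arbitrary
  field to the complex numbers, where absolute values are available.\<close>

lemma not_algebraic_int_root_of_unity_minus_1: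
  fixes z :: "'a::field_char_0" and a b :: int
  assumes z: "z ^ N = 1" "N > 0" "z \<noteq> 1" and ab: "b \<noteq> 0" "2 * \<bar>b\<bar> < \<bar>a\<bar>"
  shows "\<not> algebraic_int (of_int b / of_int a * (z - 1))"
proof
  assume "algebraic_int (of_int b / of_int a * (z - 1))"
  then obtain p :: "int poly" where p: "poly (map_poly of_int p) (of_int b / of_int a * (z - 1)) = 0" "lead_coeff p = 1"
    unfolding algebraic_int_altdef_ipoly by blast
  define r :: rat where "r = of_int b / of_int a"
  \<comment> \<open>The roots of \<open>f\<close> are the \<open>N\<close>-th roots of unity other
    than 1, and \<open>h\<close> vanishes at \<open>t\<close> exactly when \<open>p\<close> vanishes
    at \<open>b / a * (t - 1)\<close>.\<close>
  define f where "f = (\<Sum>i<N. monom 1 i :: rat poly)"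
  define h where "h = pcompose (map_poly of_int p :: rat poly) [:- r, r:]"
  \<comment> \<open>Stated over an arbitrary field, to be used both at \<open>z\<close> and at
    complex roots.\<close>
  have f_eval: "poly (map_poly of_rat f) t = (\<Sum>i<N. t ^ i)" for t :: "'b::field_char_0"
    unfolding f_def by (simp add: map_of_rat_hom.hom_sum map_poly_monom poly_sum poly_monom)
  have h_eval: "poly (map_poly of_rat h) t = poly (map_poly of_int p) (of_int b / of_int a * (t - 1))"
    for t :: "'b::field_char_0"
  proof -
    have "map_poly of_rat (map_poly of_int p :: rat poly) = (map_poly of_int p :: 'b poly)"
      by (simp add: map_poly_map_poly o_def)
    moreover have "map_poly of_rat [:- r, r:] = [:- (of_int b / of_int a), of_int b / of_int a :: 'b:]"
      by (rule poly_eqI) (simp add: coeff_map_poly coeff_pCons r_def of_rat_divide of_rat_minus split: nat.split)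
    ultimately show ?thesis unfolding h_def
      by (simp add: of_rat_hom.map_poly_pcompose poly_pcompose ring_distribs diff_divide_distrib mult.commute)
  qed
  \<comment> \<open>The gcd stands in for the minimal polynomial of \<open>z\<close>: it is
    rational, vanishes at \<open>z\<close> by Bezout, and each of its roots is a root of both
    \<open>f\<close> and \<open>h\<close>.\<close>
  define g where "g = gcd f h"
  have "coeff f 0 = 1" using z(2) by (simp add: f_def coeff_sum)
  hence "f \<noteq> 0" by auto
  hence "g \<noteq> 0" by (simp add: g_def)
  have g_z: "poly (map_poly of_rat g) z = 0"
  proof -
    have fz: "poly (map_poly of_rat f) z = 0"
      using z sum_gp_strict[of z N] by (simp add: f_eval)
    have hz: "poly (map_poly of_rat h) z = 0"
      using p(1) by (simp only: h_eval)
    obtain s t where "s * f + t * h = g"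
      using bezout_coefficients_fst_snd[of f h] unfolding g_def by blast
    thus ?thesis using fz hz by (metis map_of_rat_hom.hom_add map_of_rat_hom.hom_mult poly_add poly_mult mult_zero_right add_0)
  qed
  define gc :: "complex poly" where "gc = map_poly of_rat g"
  have "gc \<noteq> 0" using \<open>g \<noteq> 0\<close> by (simp add: gc_def)
  then obtain M where M: "size M = degree gc" "gc = smult (lead_coeff gc) (\<Prod>x\<in>#M. [:-x, 1:])"
    using alg_closed_imp_factorization by blast
  \<comment> \<open>\<open>g\<close> is nonzero with root \<open>z\<close>, hence not constant; this
    keeps the product over \<open>M\<close> below from being empty.\<close>
  have "degree gc \<noteq> 0"
  proof
    assume "degree gc = 0"
    hence "degree g = 0" by (simp add: gc_def)
    then obtain k where "g = [:k:]" using degree_eq_zeroE by blast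
    thus False using g_z \<open>g \<noteq> 0\<close> by simp
  qed
  hence M_ne: "M \<noteq> {#}" using M(1) by auto
  have root: "t ^ N = 1" "t \<noteq> 1" "algebraic_int (of_int b / of_int a * (t - 1))" if t: "t \<in># M" for t
  proof -
    have "poly gc t = 0"
      using t by (subst M(2)) (auto simp: poly_prod_mset prod_mset_zero_iff)
    hence *: "poly (map_poly of_rat k) t = 0" if "g dvd k" for k
      using that unfolding gc_def by (metis dvdE map_of_rat_hom.hom_mult poly_mult mult_zero_left)
    have ft: "(\<Sum>i<N. t ^ i) = 0" using *[of f] f_eval[of t] by (simp add: g_def)
    thus "t \<noteq> 1" using z(2) by auto
    thus "t ^ N = 1" using ft by (simp add: sum_gp_strict)
    have "poly (map_poly of_int p) (of_int b / of_int a * (t - 1)) = 0"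
      using *[of h] h_eval[of t] by (simp add: g_def)
    thus "algebraic_int (of_int b / of_int a * (t - 1))"
      unfolding algebraic_int_altdef_ipoly using p(2) by blast
  qed
  define k :: complex where "k = of_int b / of_int a"
  \<comment> \<open>Up to the factor \<open>(- k) ^ size M\<close>, this is the value of
    \<open>gc\<close> at 1 divided by its leading coefficient, hence rational.\<close>
  define B where "B = (\<Prod>t\<in>#M. k * (t - 1))"
  have "algebraic_int B" unfolding B_def k_def by (intro algebraic_int_prod_mset root)
  moreover have "B \<in> \<rat>"
  proof -
    have "(\<Prod>t\<in>#M. 1 - t) = poly gc 1 / lead_coeff gc"
      using \<open>gc \<noteq> 0\<close> by (subst M(2)) (simp add: poly_prod_mset)
    also have "\<dots> = of_rat (poly g 1 / lead_coeff g)"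
      by (simp add: gc_def of_rat_divide degree_map_poly coeff_map_poly flip: of_rat_hom.poly_map_poly_1)
    finally have "(\<Prod>t\<in>#M. 1 - t) \<in> \<rat>" by simp
    moreover have "B = (- k) ^ size M * (\<Prod>t\<in>#M. 1 - t)"
      unfolding B_def by (induction M) (simp_all add: algebra_simps)
    moreover have "k \<in> \<rat>" by (simp add: k_def)
    ultimately show ?thesis by simp
  qed
  ultimately have "B \<in> \<int>" by (rule rational_algebraic_int_is_int)
  moreover have "B \<noteq> 0"
    unfolding B_def k_def using root(2) ab by (auto simp: prod_mset_zero_iff)
  moreover have "norm B < 1"
  proof -
    have small: "norm (k * (t - 1)) < 1" if t: "t \<in># M" for t
    proof -
      have "norm t ^ N = 1 ^ N" using root(1)[OF t] by (metis norm_one norm_power power_one)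
      hence "norm t = 1" using z(2) power_eq_imp_eq_base[of "norm t" N 1] by simp
      hence "norm (t - 1) \<le> 2" using norm_triangle_ineq4[of t 1] by simp
      hence "norm (k * (t - 1)) \<le> norm k * 2"
        unfolding norm_mult by (intro mult_left_mono) auto
      also have "norm k = \<bar>of_int b\<bar> / \<bar>of_int a\<bar>" by (simp add: k_def norm_divide)
      also have "\<bar>of_int b\<bar> / \<bar>of_int a\<bar> * 2 < (1::real)"
      proof -
        have "2 * \<bar>real_of_int b\<bar> < \<bar>real_of_int a\<bar>"
          using ab(2) by linarith
        thus ?thesis by (simp add: divide_simps)
      qed
      finally show ?thesis .
    qed
    \<comment> \<open>The empty product has norm 1, so the strict bound is proved only for nonempty
      multisets with elements from \<open>M\<close>.\<close>
    have "norm (\<Prod>t\<in>#M'. k * (t - 1)) < 1" if "M' \<noteq> {#}" "set_mset M' \<subseteq> set_mset M" for M'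
      using that
    proof (induction M')
      case (add t M')
      have t: "norm (k * (t - 1)) < 1" using small add.prems by simp
      have "norm (\<Prod>t\<in>#M'. k * (t - 1)) \<le> 1"
        using add by (cases "M' = {#}") auto
      hence "norm (k * (t - 1)) * norm (\<Prod>t\<in>#M'. k * (t - 1)) \<le> norm (k * (t - 1)) * 1"
        by (intro mult_left_mono) auto
      thus ?case using t by (simp add: norm_mult)
    qed simp
    thus ?thesis using M_ne unfolding B_def by blast
  qed
  ultimately show False by (auto elim!: Ints_cases)
qed

section \<open>Subfields, bases and norms\<close>

lemma amb_simps [simp]:
  "carrier amb = UNIV" "\<zero>\<^bsub>amb\<^esub> = 0" "\<one>\<^bsub>amb\<^esub> = 1"
  "x \<oplus>\<^bsub>amb\<^esub> y = x + y" "x \<otimes>\<^bsub>amb\<^esub> y = x * y"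
  by (simp_all add: ring_of_type_algebra_def)

lemma field_amb: "field (amb :: 'a::field ring)"
  by (rule field_from_type_algebra)

lemma ring_amb: "ring (amb :: 'a::field ring)"
  by (rule ring_from_type_algebra)

lemma domain_amb: "domain (amb :: 'a::field ring)"
  using field_amb by (rule field.axioms)

lemma a_inv_amb [simp]: "\<ominus>\<^bsub>amb\<^esub> x = - x"
proof -
  interpret field "amb :: 'a ring" by (rule field_amb)
  have "\<ominus>\<^bsub>amb\<^esub> x \<oplus>\<^bsub>amb\<^esub> x = \<zero>\<^bsub>amb\<^esub>" by (rule l_neg) simp
  thus ?thesis by (simp add: eq_neg_iff_add_eq_0)
qed

lemma m_inv_amb [simp]:
  assumes "x \<noteq> 0"
  shows "inv\<^bsub>amb\<^esub> x = inverse x"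
proof -
  interpret field "amb :: 'a ring" by (rule field_amb)
  have "inv\<^bsub>amb\<^esub> x \<otimes>\<^bsub>amb\<^esub> x = \<one>\<^bsub>amb\<^esub>" using assms by (intro Units_l_inv) (auto simp: field_Units)
  thus ?thesis using assms by (simp add: field_simps)
qed

lemma nat_pow_amb [simp]: "x [^]\<^bsub>amb\<^esub> (n::nat) = x ^ n"
proof -
  interpret field "amb :: 'a ring" by (rule field_amb)
  show ?thesis by (induction n) (simp_all add: mult.commute)
qed

locale field_subset =
  fixes F :: "'a::field set"
  assumes subfield: "subfield F amb"
begin

lemma closed [simp, intro]:
  "0 \<in> F" "1 \<in> F"
  "x \<in> F \<Longrightarrow> y \<in> F \<Longrightarrow> x + y \<in> F" "x \<in> F \<Longrightarrow> y \<in> F \<Longrightarrow> x * y \<in> F"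
  "x \<in> F \<Longrightarrow> - x \<in> F"
  using subringE[OF subfieldE(1)[OF subfield]] by auto

lemma inverse_closed [simp, intro]: "x \<in> F \<Longrightarrow> inverse x \<in> F"
  using ring.subfield_m_inv(1)[OF ring_amb subfield, of x] by (cases "x = 0") auto

lemma closed_derived [simp, intro]:
  "x \<in> F \<Longrightarrow> y \<in> F \<Longrightarrow> x - y \<in> F" "x \<in> F \<Longrightarrow> y \<in> F \<Longrightarrow> x / y \<in> F"
  using closed(3)[of x "- y"] by (auto simp: divide_inverse)

lemma power_closed [simp, intro]: "x \<in> F \<Longrightarrow> x ^ n \<in> F"
  by (induction n) auto

lemma of_nat_closed [simp, intro]: "of_nat n \<in> F"
  by (induction n) auto

lemma of_int_closed [simp, intro]: "of_int k \<in> F"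
  by (cases k) auto

lemma powi_closed [simp, intro]: "x \<in> F \<Longrightarrow> x powi k \<in> F"
  by (auto simp: power_int_def)

lemma sum_closed: "(\<And>i. i \<in> A \<Longrightarrow> f i \<in> F) \<Longrightarrow> sum f A \<in> F"
  by (induction A rule: infinite_finite_induct) auto

lemma prod_closed: "(\<And>i. i \<in> A \<Longrightarrow> f i \<in> F) \<Longrightarrow> prod f A \<in> F"
  by (induction A rule: infinite_finite_induct) auto

text \<open>The Leibniz formula uses only sums, products and signs.\<close>

lemma det_closed:
  assumes "elements_mat A \<subseteq> F" "A \<in> carrier_mat n n"
  shows "det A \<in> F"
proof -
  have "A $$ (i, p i) \<in> F" if "i < n" "p permutes {0..<n}" for i p
    using assms that permutes_in_image[of p "{0..<n}" i] by (intro subsetD[OF assms(1)] elements_matI[of A n n]) auto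
  moreover have "signof p \<in> F" for p :: "nat \<Rightarrow> nat" by (simp add: sign_def)
  ultimately show ?thesis
    unfolding det_def'[OF assms(2)] by (intro sum_closed closed prod_closed) auto
qed

end

lemma field_subset_adjoin: "field_subset (adjoin K S)"
  unfolding adjoin_def
  by (rule field_subset.intro) (simp add: field.generate_field_is_subfield[OF field_amb])

lemma adjoin_superset: "K \<subseteq> adjoin K S" "S \<subseteq> adjoin K S"
  unfolding adjoin_def by (auto intro: generate_field.incl)

lemma adjoin_least:
  assumes "subfield F amb" "K \<subseteq> F" "S \<subseteq> F"
  shows "adjoin K S \<subseteq> F"
  unfolding adjoin_def using assms
  by (intro field.generate_field_min_subfield1[OF field_amb]) auto

lemma combine_amb:
  "length Ks = length Us \<Longrightarrow> ring.combine amb Ks Us = (\<Sum>i<length Us. Ks ! i * Us ! i)"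
proof (induction Ks Us rule: list_induct2)
  case Nil
  show ?case by (simp add: ring.combine.simps[OF ring_amb])
next
  case (Cons k Ks u Us)
  thus ?case by (simp add: ring.combine.simps[OF ring_amb] sum.lessThan_Suc_shift del: sum.lessThan_Suc)
qed

section \<open>Coordinates with respect to a basis\<close>

context field_subset
begin

text \<open>Coefficients form a function rather than a list, so that column \<open>j\<close> of a
  matrix can be inserted as \<open>\<lambda>i. A $$ (i, j)\<close>. Values from
  \<open>length vs\<close> on do not matter.\<close>

definition lin_comb :: "'a list \<Rightarrow> (nat \<Rightarrow> 'a) \<Rightarrow> 'a"
  where "lin_comb vs c = (\<Sum>i<length vs. c i * vs ! i)"

lemma Span_iff: "z \<in> ring.Span amb F vs \<longleftrightarrow> (\<exists>c. (\<forall>i<length vs. c i \<in> F) \<and> z = lin_comb vs c)"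
proof
  assume "z \<in> ring.Span amb F vs"
  then obtain Ks where Ks: "set Ks \<subseteq> F" "length Ks = length vs" "z = ring.combine amb Ks vs"
    using ring.Span_mem_iff_length_version[OF ring_amb subfield, of vs z]
    by (simp only: amb_simps subset_UNIV) blast
  have "\<forall>i<length vs. Ks ! i \<in> F" using subsetD[OF Ks(1)] Ks(2) nth_mem[of _ Ks] by simp
  moreover have "z = lin_comb vs ((!) Ks)" using Ks(2,3) by (simp add: combine_amb lin_comb_def)
  ultimately show "\<exists>c. (\<forall>i<length vs. c i \<in> F) \<and> z = lin_comb vs c" by blast
next
  assume "\<exists>c. (\<forall>i<length vs. c i \<in> F) \<and> z = lin_comb vs c"
  then obtain c where "\<forall>i<length vs. c i \<in> F" "z = lin_comb vs c" by blast
  hence "set (map c [0..<length vs]) \<subseteq> F \<and> length (map c [0..<length vs]) = length vs \<and>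
      z = ring.combine amb (map c [0..<length vs]) vs"
    by (auto simp: combine_amb lin_comb_def)
  thus "z \<in> ring.Span amb F vs"
    using ring.Span_mem_iff_length_version[OF ring_amb subfield, of vs z] by (simp only: amb_simps subset_UNIV) blast
qed

lemma independent_iff:
  "ring.independent amb F vs \<longleftrightarrow>
     (\<forall>c. (\<forall>i<length vs. c i \<in> F) \<longrightarrow> lin_comb vs c = 0 \<longrightarrow> (\<forall>i<length vs. c i = 0))"
proof
  assume ind: "ring.independent amb F vs"
  show "\<forall>c. (\<forall>i<length vs. c i \<in> F) \<longrightarrow> lin_comb vs c = 0 \<longrightarrow> (\<forall>i<length vs. c i = 0)"
  proof (intro allI impI)
    fix c i assume c: "\<forall>i<length vs. c i \<in> F" "lin_comb vs c = 0" and i: "i < length vs"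
    have "set (take (length vs) (map c [0..<length vs])) \<subseteq> {\<zero>\<^bsub>amb\<^esub>}"
      by (rule ring.independent_imp_trivial_combine[OF ring_amb subfield ind])
        (use c in \<open>auto simp: combine_amb lin_comb_def\<close>)
    hence "c ` {0..<length vs} \<subseteq> {0}" by simp
    thus "c i = 0" using i by (auto simp: image_subset_iff)
  qed
next
  assume triv: "\<forall>c. (\<forall>i<length vs. c i \<in> F) \<longrightarrow> lin_comb vs c = 0 \<longrightarrow> (\<forall>i<length vs. c i = 0)"
  show "ring.independent amb F vs"
  proof (rule ccontr)
    assume "\<not> ring.independent amb F vs"
    then obtain Ks where Ks: "length Ks = length vs" "ring.combine amb Ks vs = \<zero>\<^bsub>amb\<^esub>"
        "set Ks \<subseteq> F" "set Ks \<noteq> {\<zero>\<^bsub>amb\<^esub>}"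
      using ring.dependent_imp_non_trivial_combine[OF ring_amb subfield, of vs] by auto
    have "\<forall>i<length vs. Ks ! i \<in> F"
    proof (intro allI impI)
      fix i assume "i < length vs"
      hence "Ks ! i \<in> set Ks" using Ks(1) by simp
      thus "Ks ! i \<in> F" using Ks(3) by (rule subsetD[rotated])
    qed
    moreover have "lin_comb vs ((!) Ks) = 0"
      using Ks(1,2) by (simp add: combine_amb lin_comb_def)
    ultimately have "\<forall>i<length vs. Ks ! i = 0"
      using triv[THEN spec, of "(!) Ks"] by blast
    \<comment> \<open>An all-zero list has a set other than \<open>{0}\<close> only when it is
      empty, and the empty family is independent.\<close>
    hence "set Ks \<subseteq> {0}" using Ks(1) by (auto simp: in_set_conv_nth)
    hence "Ks = []" using Ks(4) by (cases Ks) auto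
    hence "vs = []" using Ks(1) by simp
    thus False using \<open>\<not> ring.independent amb F vs\<close> ring.li_Nil[OF ring_amb] by blast
  qed
qed

lemma basis_over_iff:
  "basis_over F L vs \<longleftrightarrow>
     (\<forall>c. (\<forall>i<length vs. c i \<in> F) \<longrightarrow> lin_comb vs c = 0 \<longrightarrow> (\<forall>i<length vs. c i = 0)) \<and>
     L = {lin_comb vs c | c. \<forall>i<length vs. c i \<in> F}"
proof -
  have "ring.Span amb F vs = {lin_comb vs c | c. \<forall>i<length vs. c i \<in> F}"
    by (rule Set.set_eqI) (simp only: Span_iff mem_Collect_eq conj_commute)
  thus ?thesis unfolding basis_over_def independent_iff by (simp only: eq_commute[of _ L])
qed

lemma basis_coeffs_eq:
  assumes "basis_over F L vs"
    and "\<And>i. i < length vs \<Longrightarrow> c i \<in> F" "\<And>i. i < length vs \<Longrightarrow> d i \<in> F"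
    and "lin_comb vs c = lin_comb vs d" "i < length vs"
  shows "c i = d i"
proof -
  have eq: "lin_comb vs (\<lambda>i. c i - d i) = 0"
    using assms(4) by (simp add: lin_comb_def left_diff_distrib sum_subtractf)
  have mem: "\<forall>i<length vs. c i - d i \<in> F" using assms(2,3) by simp
  have "\<forall>i<length vs. c i - d i = 0"
    by (rule conjunct1[OF assms(1)[unfolded basis_over_iff], THEN spec, THEN mp, THEN mp, OF mem eq])
  thus ?thesis using assms(5) by simp
qed

lemma basis_mem: "basis_over F L vs \<Longrightarrow> (\<And>i. i < length vs \<Longrightarrow> c i \<in> F) \<Longrightarrow> lin_comb vs c \<in> L"
  unfolding basis_over_iff by blast

lemma basis_nth_mem:
  assumes "basis_over F L vs" "j < length vs"
  shows "vs ! j \<in> L"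
proof -
  have "(\<Sum>i<length vs. (if i = j then 1 else 0) * vs ! i) = (\<Sum>i<length vs. if i = j then vs ! i else 0)"
    by (intro sum.cong) auto
  hence "lin_comb vs (\<lambda>i. if i = j then 1 else 0) = vs ! j"
    using assms(2) by (simp add: lin_comb_def)
  thus ?thesis using basis_mem[OF assms(1), of "\<lambda>i. if i = j then 1 else 0"] by simp
qed

lemma basis_coeffs_exist:
  assumes "basis_over F L vs" "z \<in> L"
  obtains c where "\<forall>i<length vs. c i \<in> F" "z = lin_comb vs c"
proof -
  have "L = {lin_comb vs c | c. \<forall>i<length vs. c i \<in> F}"
    using assms(1) by (rule basis_over_iff[THEN iffD1, THEN conjunct2])
  hence "\<exists>c. z = lin_comb vs c \<and> (\<forall>i<length vs. c i \<in> F)"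
    using assms(2) by simp
  thus thesis using that by auto
qed

lemma basis_length_eq:
  assumes "basis_over F L vs"
  shows "length vs = degree_ext L F"
proof -
  have "ring.dimension amb (length vs) F L"
    using ring.dimensionI[OF ring_amb subfield] assms unfolding basis_over_def by blast
  hence "(ring.dim amb over F) L = length vs"
    by (rule ring.dimI[OF ring_amb subfield])
  thus ?thesis by (simp add: degree_ext_def over_def)
qed

end

lemma elements_mat_subset_iff:
  assumes "A \<in> carrier_mat n m"
  shows "elements_mat A \<subseteq> S \<longleftrightarrow> (\<forall>i<n. \<forall>j<m. A $$ (i, j) \<in> S)"
proof
  show "\<forall>i<n. \<forall>j<m. A $$ (i, j) \<in> S" if "elements_mat A \<subseteq> S"
    using elements_matI[OF assms] that by blast
  show "elements_mat A \<subseteq> S" if "\<forall>i<n. \<forall>j<m. A $$ (i, j) \<in> S"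
  proof
    fix x assume "x \<in> elements_mat A"
    then obtain i j where "i < dim_row A" "j < dim_col A" "x = A $$ (i, j)" by auto
    thus "x \<in> S" using that assms by auto
  qed
qed

section \<open>Matrices of multiplication and their determinants\<close>

context field_subset
begin

lemma mult_matrix_iff:
  "mult_matrix F vs z A \<longleftrightarrow> A \<in> carrier_mat (length vs) (length vs) \<and>
     (\<forall>i<length vs. \<forall>j<length vs. A $$ (i, j) \<in> F) \<and>
     (\<forall>j<length vs. z * vs ! j = lin_comb vs (\<lambda>i. A $$ (i, j)))"
proof (cases "A \<in> carrier_mat (length vs) (length vs)")
  case True
  show ?thesis unfolding mult_matrix_def elements_mat_subset_iff[OF True] lin_comb_def ..
qed (simp add: mult_matrix_def)

lemma mat_mult_closed:
  assumes "A \<in> carrier_mat n m" "B \<in> carrier_mat m k"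
    and "\<forall>i<n. \<forall>j<m. A $$ (i, j) \<in> F" "\<forall>i<m. \<forall>j<k. B $$ (i, j) \<in> F"
  shows "\<forall>i<n. \<forall>j<k. (A * B) $$ (i, j) \<in> F"
proof (intro allI impI)
  fix i j assume ij: "i < n" "j < k"
  have "(A * B) $$ (i, j) = (\<Sum>p = 0..<m. A $$ (i, p) * B $$ (p, j))"
    using assms(1,2) ij by (simp add: scalar_prod_def)
  also have "\<dots> \<in> F" using assms(3,4) ij by (intro sum_closed closed) auto
  finally show "(A * B) $$ (i, j) \<in> F" .
qed

lemma lin_comb_mat_mult:
  assumes "A \<in> carrier_mat (length vs) m" "B \<in> carrier_mat m k" "j < k"
  shows "lin_comb vs (\<lambda>i. (A * B) $$ (i, j)) = (\<Sum>p<m. B $$ (p, j) * lin_comb vs (\<lambda>i. A $$ (i, p)))"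
proof -
  have "lin_comb vs (\<lambda>i. (A * B) $$ (i, j)) = (\<Sum>i<length vs. (\<Sum>p<m. A $$ (i, p) * B $$ (p, j)) * vs ! i)"
    unfolding lin_comb_def using assms
    by (intro sum.cong) (simp_all add: scalar_prod_def atLeast0LessThan)
  also have "\<dots> = (\<Sum>i<length vs. \<Sum>p<m. B $$ (p, j) * (A $$ (i, p) * vs ! i))"
    by (intro sum.cong) (simp_all add: sum_distrib_left mult.commute mult.left_commute)
  also have "\<dots> = (\<Sum>p<m. \<Sum>i<length vs. B $$ (p, j) * (A $$ (i, p) * vs ! i))"
    by (rule sum.swap)
  finally show ?thesis by (simp add: lin_comb_def sum_distrib_left)
qed

text \<open>Links products in the field to products of matrices; both the change of basis and the
  multiplicativity of the norm rest on it.\<close>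

lemma mult_lin_comb:
  assumes "mult_matrix F vs z A" "B \<in> carrier_mat (length vs) k" "j < k"
  shows "z * lin_comb vs (\<lambda>i. B $$ (i, j)) = lin_comb vs (\<lambda>i. (A * B) $$ (i, j))"
proof -
  have A: "A \<in> carrier_mat (length vs) (length vs)"
    and Az: "\<And>p. p < length vs \<Longrightarrow> z * vs ! p = lin_comb vs (\<lambda>i. A $$ (i, p))"
    using assms(1) by (simp_all add: mult_matrix_iff)
  have "z * lin_comb vs (\<lambda>i. B $$ (i, j)) = (\<Sum>p<length vs. B $$ (p, j) * (z * vs ! p))"
    by (simp add: lin_comb_def sum_distrib_left mult_ac)
  also have "\<dots> = (\<Sum>p<length vs. B $$ (p, j) * lin_comb vs (\<lambda>i. A $$ (i, p)))"
    by (intro sum.cong) (simp_all add: Az)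
  finally show ?thesis by (simp add: lin_comb_mat_mult[OF A assms(2,3)])
qed

lemma lin_comb_one_mat:
  assumes "j < length vs"
  shows "lin_comb vs (\<lambda>i. 1\<^sub>m (length vs) $$ (i, j)) = vs ! j"
proof -
  have "lin_comb vs (\<lambda>i. 1\<^sub>m (length vs) $$ (i, j)) = (\<Sum>i<length vs. if i = j then vs ! i else 0)"
    unfolding lin_comb_def using assms by (intro sum.cong) auto
  thus ?thesis using assms by simp
qed

text \<open>Uniqueness of coordinates turns a matrix identity into one identity of field elements
  per column.\<close>

lemma basis_mat_eqI:
  assumes "basis_over F L vs"
    and "A \<in> carrier_mat (length vs) k" "B \<in> carrier_mat (length vs) k"
    and "\<forall>i<length vs. \<forall>j<k. A $$ (i, j) \<in> F" "\<forall>i<length vs. \<forall>j<k. B $$ (i, j) \<in> F"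
    and "\<And>j. j < k \<Longrightarrow> lin_comb vs (\<lambda>i. A $$ (i, j)) = lin_comb vs (\<lambda>i. B $$ (i, j))"
  shows "A = B"
proof (rule eq_matI)
  fix i j assume "i < dim_row B" "j < dim_col B"
  hence ij: "i < length vs" "j < k" using assms(3) by auto
  show "A $$ (i, j) = B $$ (i, j)"
    by (rule basis_coeffs_eq[OF assms(1), of "\<lambda>i. A $$ (i, j)" "\<lambda>i. B $$ (i, j)"])
      (use assms(4-6) ij in auto)
qed (use assms(2,3) in auto)

lemma basis_mat_exists:
  assumes "basis_over F L vs" "\<And>j. j < k \<Longrightarrow> w j \<in> L"
  obtains A where "A \<in> carrier_mat (length vs) k" "\<forall>i<length vs. \<forall>j<k. A $$ (i, j) \<in> F"
    "\<And>j. j < k \<Longrightarrow> w j = lin_comb vs (\<lambda>i. A $$ (i, j))"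
proof -
  have "\<forall>j. \<exists>c. j < k \<longrightarrow> (\<forall>i<length vs. c i \<in> F) \<and> w j = lin_comb vs c"
    using basis_coeffs_exist[OF assms(1) assms(2)] by metis
  then obtain C where C: "\<And>j. j < k \<Longrightarrow> (\<forall>i<length vs. C j i \<in> F) \<and> w j = lin_comb vs (C j)"
    by metis
  show thesis
  proof (rule that[of "mat (length vs) k (\<lambda>(i, j). C j i)"])
    fix j assume j: "j < k"
    show "w j = lin_comb vs (\<lambda>i. mat (length vs) k (\<lambda>(i, j). C j i) $$ (i, j))"
      using C[OF j] j by (simp add: lin_comb_def)
  qed (use C in auto)
qed

lemma mult_matrix_exists:
  assumes "basis_over F L vs" "\<And>w. w \<in> L \<Longrightarrow> z * w \<in> L"
  obtains A where "mult_matrix F vs z A"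
proof -
  obtain A where "A \<in> carrier_mat (length vs) (length vs)" "\<forall>i<length vs. \<forall>j<length vs. A $$ (i, j) \<in> F"
    "\<And>j. j < length vs \<Longrightarrow> z * vs ! j = lin_comb vs (\<lambda>i. A $$ (i, j))"
    using basis_mat_exists[OF assms(1), of "length vs" "\<lambda>j. z * vs ! j"] basis_nth_mem[OF assms(1)] assms(2)
    by metis
  thus thesis using that[of A] by (simp add: mult_matrix_iff)
qed

text \<open>Let \<open>P\<close> hold the coordinates of \<open>ws\<close> in \<open>vs\<close>.
  Column \<open>j\<close> of either side of \<open>A * P = P * B\<close> consists of the coordinates
  of \<open>z * ws ! j\<close>, so the determinants agree once \<open>det P\<close> is cancelled.
  This makes the \<open>THE\<close> in \<open>field_norm\<close> meaningful.\<close>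

lemma mult_matrix_det_unique:
  assumes vs: "basis_over F L vs" and ws: "basis_over F L ws"
    and A: "mult_matrix F vs z A" and B: "mult_matrix F ws z B"
  shows "det A = det B"
proof -
  define n where "n = length vs"
  have len: "length vs = n" "length ws = n"
    using basis_length_eq[OF vs] basis_length_eq[OF ws] by (simp_all add: n_def)
  obtain P where P: "P \<in> carrier_mat n n" "\<forall>i<n. \<forall>j<n. P $$ (i, j) \<in> F"
      "\<And>j. j < n \<Longrightarrow> ws ! j = lin_comb vs (\<lambda>i. P $$ (i, j))"
    using basis_mat_exists[OF vs, of n "(!) ws"] basis_nth_mem[OF ws] unfolding len by metis
  obtain Q where Q: "Q \<in> carrier_mat n n" "\<forall>i<n. \<forall>j<n. Q $$ (i, j) \<in> F"
      "\<And>j. j < n \<Longrightarrow> vs ! j = lin_comb ws (\<lambda>i. Q $$ (i, j))"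
    using basis_mat_exists[OF ws, of n "(!) vs"] basis_nth_mem[OF vs] unfolding len by metis
  have Ac: "A \<in> carrier_mat n n" "\<forall>i<n. \<forall>j<n. A $$ (i, j) \<in> F"
    and Bc: "B \<in> carrier_mat n n" "\<forall>i<n. \<forall>j<n. B $$ (i, j) \<in> F"
      "\<And>j. j < n \<Longrightarrow> z * ws ! j = lin_comb ws (\<lambda>i. B $$ (i, j))"
    using A B by (simp_all add: mult_matrix_iff len)
  \<comment> \<open>\<open>P\<close> converts coordinates in \<open>ws\<close> to coordinates in
    \<open>vs\<close>.\<close>
  have change: "lin_comb vs (\<lambda>i. (P * C) $$ (i, j)) = lin_comb ws (\<lambda>i. C $$ (i, j))"
    if "C \<in> carrier_mat n n" "j < n" for C j
    using that P(3) by (subst lin_comb_mat_mult[of P vs n C n]) (use P(1) in \<open>simp_all add: len lin_comb_def\<close>)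
  \<comment> \<open>Passing between the two bases and back is the identity, which makes
    \<open>det P\<close> nonzero.\<close>
  have "P * Q = 1\<^sub>m n"
  proof (rule basis_mat_eqI[OF vs, of _ n], unfold len)
    show "\<forall>i<n. \<forall>j<n. (P * Q) $$ (i, j) \<in> F" by (rule mat_mult_closed[OF P(1) Q(1) P(2) Q(2)])
    fix j assume j: "j < n"
    show "lin_comb vs (\<lambda>i. (P * Q) $$ (i, j)) = lin_comb vs (\<lambda>i. 1\<^sub>m n $$ (i, j))"
      using change[OF Q(1) j] Q(3)[OF j] lin_comb_one_mat[of j vs] j by (simp add: len)
  qed (use P(1) Q(1) in auto)
  hence "det P * det Q = 1" using det_mult[OF P(1) Q(1)] by simp
  hence "det P \<noteq> 0" by auto
  have "A * P = P * B"
  proof (rule basis_mat_eqI[OF vs, of _ n], unfold len)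
    show "\<forall>i<n. \<forall>j<n. (A * P) $$ (i, j) \<in> F" by (rule mat_mult_closed[OF Ac(1) P(1) Ac(2) P(2)])
    show "\<forall>i<n. \<forall>j<n. (P * B) $$ (i, j) \<in> F" by (rule mat_mult_closed[OF P(1) Bc(1) P(2) Bc(2)])
    fix j assume j: "j < n"
    show "lin_comb vs (\<lambda>i. (A * P) $$ (i, j)) = lin_comb vs (\<lambda>i. (P * B) $$ (i, j))"
      using mult_lin_comb[OF A, of P n j] P(1) P(3)[OF j] Bc(3)[OF j] change[OF Bc(1) j] j
      by (simp add: len)
  qed (use P(1) Ac(1) Bc(1) in auto)
  hence "det A * det P = det P * det B"
    using det_mult[OF Ac(1) P(1)] det_mult[OF P(1) Bc(1)] by metis
  thus ?thesis using \<open>det P \<noteq> 0\<close> by simp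
qed

text \<open>Discharges the definite description, so that later arguments can choose one convenient
  basis.\<close>

lemma field_norm_eq:
  assumes "basis_over F L vs" "mult_matrix F vs z A"
  shows "field_norm L F z = det A"
  unfolding field_norm_def
proof (rule the_equality)
  show "\<exists>vs B. basis_over F L vs \<and> mult_matrix F vs z B \<and> det A = det B"
    using assms by blast
  show "d = det A" if "\<exists>vs B. basis_over F L vs \<and> mult_matrix F vs z B \<and> d = det B" for d
    using that mult_matrix_det_unique[OF _ assms(1) _ assms(2)] by blast
qed

lemma mult_matrix_times:
  assumes "mult_matrix F vs z A" "mult_matrix F vs w B"
  shows "mult_matrix F vs (z * w) (A * B)"
proof -
  have A: "A \<in> carrier_mat (length vs) (length vs)" "\<forall>i<length vs. \<forall>j<length vs. A $$ (i, j) \<in> F"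
    and B: "B \<in> carrier_mat (length vs) (length vs)" "\<forall>i<length vs. \<forall>j<length vs. B $$ (i, j) \<in> F"
    "\<And>j. j < length vs \<Longrightarrow> w * vs ! j = lin_comb vs (\<lambda>i. B $$ (i, j))"
    using assms by (simp_all add: mult_matrix_iff)
  have "z * w * vs ! j = lin_comb vs (\<lambda>i. (A * B) $$ (i, j))" if "j < length vs" for j
    using mult_lin_comb[OF assms(1) B(1) that] B(3)[OF that] by (simp add: mult.assoc)
  thus ?thesis
    using mat_mult_closed[OF A(1) B(1) A(2) B(2)] A(1) B(1) by (simp add: mult_matrix_iff)
qed

lemma mult_matrix_scalar:
  assumes "z \<in> F"
  shows "mult_matrix F vs z (z \<cdot>\<^sub>m 1\<^sub>m (length vs))"
proof -
  have "z * vs ! j = lin_comb vs (\<lambda>i. (z \<cdot>\<^sub>m 1\<^sub>m (length vs)) $$ (i, j))" if j: "j < length vs" for j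
  proof -
    have "lin_comb vs (\<lambda>i. (z \<cdot>\<^sub>m 1\<^sub>m (length vs)) $$ (i, j)) =
        z * lin_comb vs (\<lambda>i. 1\<^sub>m (length vs) $$ (i, j))"
      unfolding lin_comb_def sum_distrib_left using j by (intro sum.cong) auto
    thus ?thesis by (simp only: lin_comb_one_mat[OF j])
  qed
  thus ?thesis using assms by (simp add: mult_matrix_iff)
qed

lemma field_norm_scalar:
  assumes "basis_over F L vs" "z \<in> F"
  shows "field_norm L F z = z ^ degree_ext L F"
  using field_norm_eq[OF assms(1) mult_matrix_scalar[OF assms(2)]] basis_length_eq[OF assms(1)]
  by (simp add: det_smult)

end

section \<open>Norms of finite extensions\<close>

locale finite_field_extension = base: field_subset F + top: field_subset L
  for F L :: "'a::field set" +
  assumes subset: "F \<subseteq> L" and finite_dim: "ring.finite_dimension amb F L"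
begin

lemma exists_basis:
  obtains vs where "basis_over F L vs"
  using ring.exists_base[OF ring_amb base.subfield] finite_dim
  unfolding ring.finite_dimension_def[OF ring_amb] basis_over_def by metis

lemma norm_mult:
  assumes "z \<in> L" "w \<in> L"
  shows "field_norm L F (z * w) = field_norm L F z * field_norm L F w"
proof -
  obtain vs where vs: "basis_over F L vs" by (rule exists_basis)
  obtain A where A: "mult_matrix F vs z A"
    by (rule base.mult_matrix_exists[OF vs, of z]) (use assms in auto)
  obtain B where B: "mult_matrix F vs w B"
    by (rule base.mult_matrix_exists[OF vs, of w]) (use assms in auto)
  have "A \<in> carrier_mat (length vs) (length vs)" "B \<in> carrier_mat (length vs) (length vs)"
    using A B by (simp_all add: mult_matrix_def)
  thus ?thesis
    by (simp add: base.field_norm_eq[OF vs A] base.field_norm_eq[OF vs B] det_mult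
      base.field_norm_eq[OF vs base.mult_matrix_times[OF A B]])
qed

lemma norm_scalar: "z \<in> F \<Longrightarrow> field_norm L F z = z ^ degree_ext L F"
  using exists_basis base.field_norm_scalar by metis

lemma norm_closed:
  assumes "z \<in> L"
  shows "field_norm L F z \<in> F"
proof -
  obtain vs where vs: "basis_over F L vs" by (rule exists_basis)
  obtain A where A: "mult_matrix F vs z A"
    by (rule base.mult_matrix_exists[OF vs, of z]) (use assms in auto)
  thus ?thesis using base.field_norm_eq[OF vs A] base.det_closed[of A "length vs"]
    by (simp add: mult_matrix_def)
qed

lemma norm_one: "field_norm L F 1 = 1"
  using norm_scalar[of 1] by simp

lemma norm_power: "z \<in> L \<Longrightarrow> field_norm L F (z ^ k) = field_norm L F z ^ k"
  by (induction k) (simp_all add: norm_one norm_mult)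

text \<open>An empty basis would span only 0, but \<open>L\<close> contains 1. Positivity of the
  degree is needed to pass from equal \<open>l\<close>-th powers to a root of unity.\<close>

lemma degree_pos: "degree_ext L F > 0"
proof (rule ccontr)
  assume deg: "\<not> degree_ext L F > 0"
  obtain vs where vs: "basis_over F L vs" by (rule exists_basis)
  have "vs = []" using base.basis_length_eq[OF vs] deg by simp
  hence "L = {0}" using vs by (simp add: base.basis_over_iff base.lin_comb_def)
  thus False using top.closed(2) by simp
qed

end

text \<open>\<open>y\<close> is algebraic over \<open>K\<close>, hence over \<open>K(x)\<close>, so
  the simple extension of \<open>K(x)\<close> by \<open>y\<close> is a field of finite degree. Two
  inclusions identify it with \<open>K(x, y)\<close>.\<close>

lemma finite_field_extension_adjoin:
  fixes K :: "'a::field set"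
  assumes K: "subfield K amb" and alg: "(ring.algebraic amb over K) y"
  shows "finite_field_extension (adjoin K {x}) (adjoin K {x, y})"
proof -
  interpret amb: domain "amb :: 'a ring" by (rule domain_amb)
  interpret F: field_subset "adjoin K {x}" by (rule field_subset_adjoin)
  interpret L: field_subset "adjoin K {x, y}" by (rule field_subset_adjoin)
  let ?F = "adjoin K {x}" and ?L = "adjoin K {x, y}"
  have FL: "?F \<subseteq> ?L"
    by (rule adjoin_least[OF L.subfield]) (use adjoin_superset(1)[of K "{x, y}"] adjoin_superset(2)[of "{x, y}" K] in auto)
  have alg_F: "(amb.algebraic over ?F) y"
    by (rule amb.algebraic_mono[OF _ alg]) (rule adjoin_superset)
  have sub: "subfield (amb.simple_extension ?F y) amb"
    using amb.simple_extension_is_subfield[OF F.subfield, of y] alg_F by simp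
  have incl: "?F \<subseteq> amb.simple_extension ?F y"
    using amb.simple_extension_incl[of ?F y] by simp
  have mem: "y \<in> amb.simple_extension ?F y"
    using amb.simple_extension_mem[OF subfieldE(1)[OF F.subfield], of y] by simp
  have "amb.simple_extension ?F y = ?L"
  proof
    show "?L \<subseteq> amb.simple_extension ?F y"
      by (rule adjoin_least[OF sub])
        (use incl mem adjoin_superset(1)[of K "{x}"] adjoin_superset(2)[of "{x}" K] in auto)
    show "amb.simple_extension ?F y \<subseteq> ?L"
      by (rule amb.simple_extension_subring_incl[OF subfieldE(1)[OF L.subfield] FL])
        (use adjoin_superset(2)[of "{x, y}" K] in auto)
  qed
  hence "amb.finite_dimension ?F ?L"
    using amb.finite_dimension_simple_extension[OF F.subfield, of y] alg_F by simp
  thus ?thesis using FL by unfold_locales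
qed

section \<open>Automorphisms and abelian extensions\<close>

text \<open>Nothing is required of \<open>s\<close> outside \<open>L\<close>. That 1 is preserved
  follows because \<open>s 1\<close> is a nonzero idempotent.\<close>

locale field_automorphism = field_subset L for L :: "'a::field set" +
  fixes s :: "'a \<Rightarrow> 'a"
  assumes bij: "bij_betw s L L"
    and add: "x \<in> L \<Longrightarrow> y \<in> L \<Longrightarrow> s (x + y) = s x + s y"
    and mult: "x \<in> L \<Longrightarrow> y \<in> L \<Longrightarrow> s (x * y) = s x * s y"
begin

lemma image_mem [simp, intro]: "x \<in> L \<Longrightarrow> s x \<in> L"
  using bij by (rule bij_betw_apply)

lemma inj: "x \<in> L \<Longrightarrow> y \<in> L \<Longrightarrow> s x = s y \<longleftrightarrow> x = y"
  using bij_betw_imp_inj_on[OF bij] by (auto simp: inj_on_def)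

lemma zero [simp]: "s 0 = 0"
  using add[of 0 0] by (simp only: closed add_0 add_cancel_right_left)

lemma eq_zero_iff: "x \<in> L \<Longrightarrow> s x = 0 \<longleftrightarrow> x = 0"
  using inj[of x 0] by simp

lemma one [simp]: "s 1 = 1"
  using mult[of 1 1] eq_zero_iff[of 1] by simp

lemma uminus: "x \<in> L \<Longrightarrow> s (- x) = - s x"
  using add[of x "- x"] by (simp add: eq_neg_iff_add_eq_0 add.commute)

lemma of_nat [simp]: "s (of_nat n) = of_nat n"
  by (induction n) (simp_all add: add)

lemma of_int [simp]: "s (of_int k) = of_int k"
  by (cases k) (simp_all add: uminus add del: of_nat_Suc)

lemma inverse: "x \<in> L \<Longrightarrow> s (inverse x) = inverse (s x)"
proof (cases "x = 0")
  case False
  assume "x \<in> L"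
  hence "s x * s (inverse x) = 1" using mult[of x "inverse x"] False by simp
  thus ?thesis by (metis inverse_unique)
qed simp

lemma power: "x \<in> L \<Longrightarrow> s (x ^ n) = s x ^ n"
  by (induction n) (simp_all add: mult)

lemma power_int: "x \<in> L \<Longrightarrow> s (x powi k) = s x powi k"
  by (simp add: power_int_def power inverse)

lemma sum: "(\<And>i. i \<in> A \<Longrightarrow> f i \<in> L) \<Longrightarrow> s (sum f A) = (\<Sum>i\<in>A. s (f i))"
  by (induction A rule: infinite_finite_induct) (simp_all add: add sum_closed)

lemma prod: "(\<And>i. i \<in> A \<Longrightarrow> f i \<in> L) \<Longrightarrow> s (prod f A) = (\<Prod>i\<in>A. s (f i))"
  by (induction A rule: infinite_finite_induct) (simp_all add: mult prod_closed)

text \<open>Applying \<open>s\<close> to \<open>poly p x = 0\<close> moves only the argument. This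
  yields both the finiteness of orbits and the integrality of conjugates.\<close>

lemma poly_root:
  assumes "\<And>i. coeff p i \<in> L" "\<And>i. s (coeff p i) = coeff p i" "x \<in> L" "poly p x = 0"
  shows "poly p (s x) = 0"
proof -
  have "s (poly p x) = poly p (s x)"
    unfolding poly_altdef using assms by (subst sum) (simp_all add: mult power)
  thus ?thesis using assms by simp
qed

lemma det:
  assumes "A \<in> carrier_mat n n" "\<forall>i<n. \<forall>j<n. A $$ (i, j) \<in> L"
  shows "det (map_mat s A) = s (det A)"
proof -
  have mem: "A $$ (i, p i) \<in> L" if "i < n" "p permutes {0..<n}" for i p
    using assms(2) that permutes_in_image[of p "{0..<n}" i] by simp
  have prod_mem: "(\<Prod>i = 0..<n. A $$ (i, p i)) \<in> L"
    and prod_eq: "s (\<Prod>i = 0..<n. A $$ (i, p i)) = (\<Prod>i = 0..<n. s (A $$ (i, p i)))"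
    if "p permutes {0..<n}" for p
    using mem[OF _ that] by (auto intro!: prod_closed prod)
  have "s (det A) = (\<Sum>p\<in>{p. p permutes {0..<n}}. signof p * (\<Prod>i = 0..<n. s (A $$ (i, p i))))"
    unfolding det_def'[OF assms(1)]
    by (subst sum) (auto simp: mult prod_mem prod_eq intro!: sum.cong)
  also have "\<dots> = det (map_mat s A)"
  proof -
    have "map_mat s A \<in> carrier_mat n n" using assms(1) by simp
    moreover have "(\<Prod>i = 0..<n. s (A $$ (i, p i))) = (\<Prod>i = 0..<n. map_mat s A $$ (i, p i))"
      if "p permutes {0..<n}" for p
      using assms(1) that permutes_in_image[of p "{0..<n}"] by (intro prod.cong) simp_all
    ultimately show ?thesis by (simp add: det_def')
  qed
  finally show ?thesis by simp
qed

text \<open>Transport of structure: \<open>s\<close> carries a basis to a basis and the matrix of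
  \<open>z\<close>, entry by entry, to the matrix of \<open>s z\<close>. The field \<open>F\<close>
  is preserved only as a set, so coefficients are moved as well.\<close>

lemma field_norm:
  assumes ext: "finite_field_extension F L" and F: "s ` F = F" and z: "z \<in> L"
  shows "field_norm L F (s z) = s (field_norm L F z)"
proof -
  interpret ext: finite_field_extension F L by (rule ext)
  obtain vs where vs: "basis_over F L vs" by (rule ext.exists_basis)
  obtain A where A: "mult_matrix F vs z A"
    by (rule ext.base.mult_matrix_exists[OF vs, of z]) (use z in auto)
  define n where "n = length vs"
  have FL: "x \<in> L" if "x \<in> F" for x using ext.subset that by blast
  have sF: "s x \<in> F" if "x \<in> F" for x using F that by blast
  have vsL: "vs ! i \<in> L" if "i < n" for i using ext.base.basis_nth_mem[OF vs] that by (simp add: n_def)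
  have lc: "ext.base.lin_comb (map s vs) (\<lambda>i. s (c i)) = s (ext.base.lin_comb vs c)"
    if "\<forall>i<n. c i \<in> F" for c
    unfolding ext.base.lin_comb_def using that vsL FL by (subst sum) (auto simp: n_def mult)
  have lin_comb_cong: "ext.base.lin_comb ws c = ext.base.lin_comb ws d"
    if "\<forall>i<length ws. c i = d i" for ws c d
    unfolding ext.base.lin_comb_def using that by (intro sum.cong) auto
  \<comment> \<open>Coefficients for \<open>map s vs\<close> are pulled back to coefficients for
    \<open>vs\<close>, using that \<open>s\<close> maps \<open>F\<close> onto
    \<open>F\<close>.\<close>
  have lift: "\<exists>d. (\<forall>i<n. d i \<in> F) \<and> (\<forall>i<n. c i = s (d i))" if "\<forall>i<n. c i \<in> F" for c
  proof -
    have "\<forall>i. \<exists>d. i < n \<longrightarrow> d \<in> F \<and> c i = s d" using that F by blast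
    thus ?thesis by metis
  qed
  have basis: "basis_over F L (map s vs)"
    unfolding ext.base.basis_over_iff length_map n_def[symmetric]
  proof (intro conjI allI impI)
    fix c i assume c: "\<forall>i<n. c i \<in> F" "ext.base.lin_comb (map s vs) c = 0" and i: "i < n"
    obtain d where d: "\<forall>i<n. d i \<in> F" "\<forall>i<n. c i = s (d i)" using lift[OF c(1)] by blast
    have "s (ext.base.lin_comb vs d) = ext.base.lin_comb (map s vs) c"
      unfolding lc[OF d(1), symmetric] by (rule lin_comb_cong) (use d in \<open>simp add: n_def\<close>)
    moreover have "ext.base.lin_comb vs d \<in> L"
      using ext.base.basis_mem[OF vs] d(1) by (simp add: n_def)
    ultimately have "ext.base.lin_comb vs d = 0" using c(2) eq_zero_iff by simp
    hence "\<forall>i<length vs. d i = 0"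
      using vs[unfolded ext.base.basis_over_iff, THEN conjunct1] d(1) unfolding n_def by blast
    thus "c i = 0" using d(2) i by (simp add: n_def)
  next
    show "L = {ext.base.lin_comb (map s vs) c |c. \<forall>i<n. c i \<in> F}"
    proof (intro equalityI subsetI)
      fix w assume "w \<in> L"
      then obtain v where v: "v \<in> L" "w = s v" using bij_betw_imp_surj_on[OF bij] by blast
      obtain c where "\<forall>i<length vs. c i \<in> F" "v = ext.base.lin_comb vs c"
        using ext.base.basis_coeffs_exist[OF vs v(1)] by blast
      thus "w \<in> {ext.base.lin_comb (map s vs) c |c. \<forall>i<n. c i \<in> F}"
        using lc[of c] v(2) sF by (intro CollectI exI[of _ "\<lambda>i. s (c i)"]) (simp add: n_def)
    next
      fix w assume "w \<in> {ext.base.lin_comb (map s vs) c |c. \<forall>i<n. c i \<in> F}"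
      then obtain c where c: "w = ext.base.lin_comb (map s vs) c" "\<forall>i<n. c i \<in> F" by blast
      show "w \<in> L" unfolding c(1) ext.base.lin_comb_def
        using c(2) FL vsL by (intro sum_closed closed) (simp_all add: n_def)
    qed
  qed
  have Ac: "A \<in> carrier_mat n n" "\<forall>i<n. \<forall>j<n. A $$ (i, j) \<in> F"
    "\<And>j. j < n \<Longrightarrow> z * vs ! j = ext.base.lin_comb vs (\<lambda>i. A $$ (i, j))"
    using A by (simp_all add: ext.base.mult_matrix_iff n_def)
  have "mult_matrix F (map s vs) (s z) (map_mat s A)"
    unfolding ext.base.mult_matrix_iff length_map n_def[symmetric]
  proof (intro conjI allI impI)
    show "map_mat s A \<in> carrier_mat n n" using Ac(1) by simp
    show "map_mat s A $$ (i, j) \<in> F" if "i < n" "j < n" for i j using Ac(1,2) that sF by simp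
    fix j assume j: "j < n"
    have "s z * map s vs ! j = s (z * vs ! j)" using j z vsL by (simp add: mult n_def)
    also have "\<dots> = ext.base.lin_comb (map s vs) (\<lambda>i. s (A $$ (i, j)))"
      using Ac(2) j by (simp add: Ac(3)[OF j] lc)
    also have "\<dots> = ext.base.lin_comb (map s vs) (\<lambda>i. map_mat s A $$ (i, j))"
      by (rule lin_comb_cong) (use Ac(1) j in \<open>simp add: n_def\<close>)
    finally show "s z * map s vs ! j = ext.base.lin_comb (map s vs) (\<lambda>i. map_mat s A $$ (i, j))" .
  qed
  hence "field_norm L F (s z) = det (map_mat s A)"
    by (rule ext.base.field_norm_eq[OF basis])
  also have "\<dots> = s (det A)" by (rule det[OF Ac(1)]) (use Ac(2) FL in blast)
  finally show ?thesis by (simp add: ext.base.field_norm_eq[OF vs A])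
qed

section \<open>Action of an automorphism on polynomials\<close>

lemma map_poly_add:
  assumes "\<forall>i. coeff p i \<in> L" "\<forall>i. coeff q i \<in> L"
  shows "map_poly s (p + q) = map_poly s p + map_poly s q"
  by (rule poly_eqI) (use assms in \<open>simp add: coeff_map_poly add\<close>)

lemma map_poly_mult:
  assumes "\<forall>i. coeff p i \<in> L" "\<forall>i. coeff q i \<in> L"
  shows "map_poly s (p * q) = map_poly s p * map_poly s q"
  by (rule poly_eqI) (use assms in \<open>simp add: coeff_map_poly coeff_mult sum mult\<close>)

lemma coeff_closed:
  "\<forall>i. coeff p i \<in> L \<Longrightarrow> \<forall>i. coeff q i \<in> L \<Longrightarrow> \<forall>i. coeff (p * q) i \<in> L"
  "\<forall>i. coeff p i \<in> L \<Longrightarrow> \<forall>i. coeff q i \<in> L \<Longrightarrow> \<forall>i. coeff (p + q) i \<in> L"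
  by (auto simp: coeff_mult intro: sum_closed)

text \<open>Closure of the coefficients is proved along with the identity because the induction step
  needs it: \<open>s\<close> is known to be multiplicative only on \<open>L\<close>.\<close>

lemma map_poly_prod:
  assumes "\<And>t. t \<in> T \<Longrightarrow> \<forall>i. coeff (f t) i \<in> L"
  shows "map_poly s (prod f T) = (\<Prod>t\<in>T. map_poly s (f t)) \<and> (\<forall>i. coeff (prod f T) i \<in> L)"
  using assms
proof (induction T rule: infinite_finite_induct)
  case (insert t T)
  have "\<forall>i. coeff (f t * prod f T) i \<in> L"
    by (rule coeff_closed(1)) (use insert in simp_all)
  thus ?case using insert by (simp add: map_poly_mult)
qed simp_all

lemma map_poly_sum:
  assumes "\<And>t. t \<in> T \<Longrightarrow> \<forall>i. coeff (f t) i \<in> L"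
  shows "map_poly s (sum f T) = (\<Sum>t\<in>T. map_poly s (f t)) \<and> (\<forall>i. coeff (sum f T) i \<in> L)"
  using assms
proof (induction T rule: infinite_finite_induct)
  case (insert t T)
  thus ?case by (simp add: map_poly_add)
qed simp_all

end

text \<open>Algebraicity is phrased with coefficient lists that begin with the leading coefficient,
  whereas \<open>Poly\<close> reads the constant term first; hence the \<open>rev\<close>. The
  nonzero head of the list makes the polynomial nonzero.\<close>

lemma algebraic_amb_poly:
  fixes K :: "'a::field set"
  assumes "subfield K amb" "(ring.algebraic amb over K) z"
  obtains p where "p \<noteq> 0" "\<And>i. coeff p i \<in> K" "poly p z = 0"
proof -
  interpret K: field_subset K by (rule field_subset.intro) (rule assms(1))
  have eval: "ring.eval amb q x = poly (Poly (rev q)) x" for q and x :: 'a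
  proof (induction q)
    case (Cons a q)
    thus ?case
      by (simp add: ring.eval.simps[OF ring_amb] Poly_append poly_monom algebra_simps nat_pow_amb)
  qed (simp add: ring.eval.simps[OF ring_amb])
  obtain q where q: "q \<in> carrier (univ_poly amb K)" "q \<noteq> []" "ring.eval amb q z = \<zero>\<^bsub>amb\<^esub>"
    using domain.algebraicE[OF domain_amb subfieldE(1)[OF assms(1)] _ assms(2)] by auto
  have pol: "set q \<subseteq> K" "hd q \<noteq> 0"
    using q(1,2) by (auto simp: univ_poly_def polynomial_def)
  show thesis
  proof (rule that[of "Poly (rev q)"])
    obtain a r where "q = a # r" using q(2) by (cases q) auto
    hence "coeff (Poly (rev q)) (length r) \<noteq> 0"
      using pol(2) by (simp add: nth_default_def nth_append)
    thus "Poly (rev q) \<noteq> 0" by (rule contrapos_nn) simp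
    show "coeff (Poly (rev q)) i \<in> K" for i
    proof (cases "i < length q")
      case True
      hence "rev q ! i \<in> set q" using nth_mem[of i "rev q"] by simp
      thus ?thesis using pol(1) True by (auto simp: nth_default_def)
    qed (simp add: nth_default_def)
    show "poly (Poly (rev q)) z = 0" using q(3) by (simp add: eval)
  qed
qed

section \<open>Galois theory of an abelian extension\<close>

locale abelian_field_extension =
  fixes K L :: "'a::field set"
  assumes abelian: "abelian_extension L K"
begin

abbreviation G :: "('a \<Rightarrow> 'a) set" where "G \<equiv> carrier (gal_group L K)"

lemma galois: "galois_extension L K"
  using abelian by (simp add: abelian_extension_def)

lemma K_subset: "x \<in> K \<Longrightarrow> x \<in> L"
  using galois by (auto simp: galois_extension_def)

lemma subfield_K: "subfield K amb" and subfield_L: "subfield L amb"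
  using galois by (auto simp: galois_extension_def)

sublocale base: field_subset K by (rule field_subset.intro) (rule subfield_K)
sublocale top: field_subset L by (rule field_subset.intro) (rule subfield_L)

lemma Gal_iff:
  "\<sigma> \<in> G \<longleftrightarrow> \<sigma> \<in> Bij L \<and> \<sigma> \<in> Ring.ring_hom (amb\<lparr>carrier := L\<rparr>) (amb\<lparr>carrier := L\<rparr>) \<and> (\<forall>k\<in>K. \<sigma> k = k)"
  by (simp add: gal_group_def)

lemma Gal_automorphism: "\<sigma> \<in> G \<Longrightarrow> field_automorphism L \<sigma>"
  using subfield_L
  by unfold_locales (auto simp: Gal_iff Bij_def Ring.ring_hom_def)

lemma Gal_fixes: "\<sigma> \<in> G \<Longrightarrow> k \<in> K \<Longrightarrow> \<sigma> k = k"
  by (simp add: Gal_iff)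

lemma fixed_imp_base: "z \<in> L \<Longrightarrow> (\<And>\<sigma>. \<sigma> \<in> G \<Longrightarrow> \<sigma> z = z) \<Longrightarrow> z \<in> K"
  using galois unfolding galois_extension_def by blast

lemma Gal_mult: "\<sigma> \<in> G \<Longrightarrow> \<tau> \<in> G \<Longrightarrow> z \<in> L \<Longrightarrow> (\<sigma> \<otimes>\<^bsub>gal_group L K\<^esub> \<tau>) z = \<sigma> (\<tau> z)"
  by (simp add: gal_group_def BijGroup_def compose_def)

lemma Gal_one: "z \<in> L \<Longrightarrow> \<one>\<^bsub>gal_group L K\<^esub> z = z"
  by (simp add: gal_group_def BijGroup_def)

sublocale Gal: comm_group "gal_group L K"
  using abelian by (simp add: abelian_extension_def)

lemma Gal_commute: "\<sigma> \<in> G \<Longrightarrow> \<tau> \<in> G \<Longrightarrow> z \<in> L \<Longrightarrow> \<sigma> (\<tau> z) = \<tau> (\<sigma> z)"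
  using Gal.m_comm[of \<sigma> \<tau>] Gal_mult by metis

text \<open>All conjugates are roots of one nonzero polynomial over \<open>K\<close>.\<close>

lemma orbit_finite:
  assumes "z \<in> L"
  shows "finite ((\<lambda>\<sigma>. \<sigma> z) ` G)"
proof -
  have "(ring.algebraic amb over K) z"
    using galois assms by (auto simp: galois_extension_def)
  then obtain p where p: "p \<noteq> 0" "\<And>i. coeff p i \<in> K" "poly p z = 0"
    using algebraic_amb_poly[OF subfield_K] by blast
  have "poly p (\<sigma> z) = 0" if "\<sigma> \<in> G" for \<sigma>
    by (rule field_automorphism.poly_root[OF Gal_automorphism[OF that]])
      (use p assms that in \<open>simp_all add: K_subset Gal_fixes\<close>)
  hence "(\<lambda>\<sigma>. \<sigma> z) ` G \<subseteq> {x. poly p x = 0}" by blast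
  thus ?thesis using poly_roots_finite[OF p(1)] finite_subset by blast
qed

text \<open>
  Lagrange interpolation through the points \<open>(\<sigma> t, \<sigma> z)\<close>: the interpolating polynomial is
  invariant under the Galois group, hence has coefficients in \<open>K\<close>.
\<close>

lemma interpolation_mem:
  assumes t: "t \<in> L" and z: "z \<in> L" and stab: "\<And>\<sigma>. \<sigma> \<in> G \<Longrightarrow> \<sigma> t = t \<Longrightarrow> \<sigma> z = z"
  shows "z * (\<Prod>u\<in>(\<lambda>\<sigma>. \<sigma> t) ` G - {t}. t - u) \<in> adjoin K {t}"
proof -
  define U where "U = (\<lambda>\<sigma>. \<sigma> t) ` G"
  \<comment> \<open>The points are collected in a set because orbits are known to be finite, while
    the group itself is not.\<close>
  define S where "S = (\<lambda>\<sigma>. (\<sigma> t, \<sigma> z)) ` G"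
  have fin: "finite U" "finite S"
  proof -
    show "finite U" unfolding U_def by (rule orbit_finite[OF t])
    have "S \<subseteq> U \<times> (\<lambda>\<sigma>. \<sigma> z) ` G" by (auto simp: S_def U_def)
    thus "finite S" using \<open>finite U\<close> orbit_finite[OF z] finite_subset by blast
  qed
  have UL: "u \<in> L" if "u \<in> U" for u
    using that t field_automorphism.image_mem[OF Gal_automorphism] by (auto simp: U_def)
  have SL: "fst v \<in> U \<and> snd v \<in> L" if "v \<in> S" for v
    using that z field_automorphism.image_mem[OF Gal_automorphism] by (auto simp: S_def U_def)
  \<comment> \<open>Lagrange basis polynomials scaled by the second coordinate, with the
    denominators left out. This is why the product of the differences \<open>t - u\<close> remains
    in the conclusion.\<close>
  define f where "f = (\<lambda>v. [:snd v:] * (\<Prod>u\<in>U - {fst v}. [:- u, 1:]))"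
  define h where "h = sum f S"
  have lin: "\<forall>i. coeff [:- u, 1:] i \<in> L" if "u \<in> U" for u
    using UL[OF that] by (auto simp: coeff_pCons split: nat.split)
  have const: "\<forall>i. coeff [:c:] i \<in> L" if "c \<in> L" for c
    using that by (auto simp: coeff_pCons split: nat.split)
  have inv: "map_poly \<sigma> h = h \<and> (\<forall>i. coeff h i \<in> L)" if \<sigma>: "\<sigma> \<in> G" for \<sigma>
  proof -
    interpret \<sigma>: field_automorphism L \<sigma> by (rule Gal_automorphism[OF \<sigma>])
    have prods: "map_poly \<sigma> (\<Prod>u\<in>U - {x}. [:- u, 1:]) = (\<Prod>u\<in>U - {x}. map_poly \<sigma> [:- u, 1:]) \<and>
        (\<forall>i. coeff (\<Prod>u\<in>U - {x}. [:- u, 1:]) i \<in> L)" for x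
      by (rule \<sigma>.map_poly_prod) (use lin in blast)
    have f_mem: "\<forall>i. coeff (f v) i \<in> L" if "v \<in> S" for v
      unfolding f_def using const[of "snd v"] SL[OF that] prods by (intro \<sigma>.coeff_closed(1)) auto
    \<comment> \<open>Products of automorphisms keep the orbit stable, and inverses give
      surjectivity.\<close>
    have \<sigma>_U: "bij_betw \<sigma> U U"
    proof (rule bij_betwI')
      show "\<sigma> x = \<sigma> y \<longleftrightarrow> x = y" if "x \<in> U" "y \<in> U" for x y
        by (rule \<sigma>.inj[OF UL[OF that(1)] UL[OF that(2)]])
      show "\<sigma> x \<in> U" if "x \<in> U" for x
      proof -
        obtain \<tau> where \<tau>: "\<tau> \<in> G" "x = \<tau> t" using \<open>x \<in> U\<close> by (auto simp: U_def)
        have "\<sigma> x = (\<sigma> \<otimes>\<^bsub>gal_group L K\<^esub> \<tau>) t" using Gal_mult[OF \<sigma> \<tau>(1) t] \<tau>(2) by simp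
        thus ?thesis unfolding U_def using Gal.m_closed[OF \<sigma> \<tau>(1)] by (rule image_eqI)
      qed
      show "\<exists>x\<in>U. y = \<sigma> x" if y: "y \<in> U" for y
      proof -
        obtain \<tau> where \<tau>: "\<tau> \<in> G" "y = \<tau> t" using y by (auto simp: U_def)
        let ?r = "inv\<^bsub>gal_group L K\<^esub> \<sigma> \<otimes>\<^bsub>gal_group L K\<^esub> \<tau>"
        have r: "?r \<in> G" using \<sigma> \<tau> by simp
        have "\<sigma> \<otimes>\<^bsub>gal_group L K\<^esub> ?r = \<tau>"
          using \<sigma> \<tau>(1) by (simp add: Gal.m_assoc[symmetric])
        hence "y = \<sigma> (?r t)" using Gal_mult[OF \<sigma> r t] \<tau>(2) by simp
        thus ?thesis using r by (auto simp: U_def)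
      qed
    qed
    let ?\<sigma> = "map_prod \<sigma> \<sigma>"
    have "inj_on ?\<sigma> S"
    proof (rule inj_onI)
      fix v w assume "v \<in> S" "w \<in> S" "?\<sigma> v = ?\<sigma> w"
      thus "v = w" using SL[of v] SL[of w] UL \<sigma>.inj by (cases v; cases w) auto
    qed
    moreover have "?\<sigma> ` S \<subseteq> S"
    proof
      fix w assume "w \<in> ?\<sigma> ` S"
      then obtain \<tau> where \<tau>: "\<tau> \<in> G" "w = (\<sigma> (\<tau> t), \<sigma> (\<tau> z))" by (auto simp: S_def)
      hence "w = ((\<sigma> \<otimes>\<^bsub>gal_group L K\<^esub> \<tau>) t, (\<sigma> \<otimes>\<^bsub>gal_group L K\<^esub> \<tau>) z)"
        using Gal_mult[OF \<sigma>] t z by simp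
      thus "w \<in> S" unfolding S_def using Gal.m_closed[OF \<sigma> \<tau>(1)] by blast
    qed
    ultimately have \<sigma>_S: "bij_betw ?\<sigma> S S"
      using endo_inj_surj[OF fin(2)] by (auto simp: bij_betw_def)
    \<comment> \<open>The summand of a point goes to the summand of the image point, so
      \<open>\<sigma>\<close> merely reorders the sum \<open>h\<close>.\<close>
    have mapf: "map_poly \<sigma> (f v) = f (?\<sigma> v)" if v: "v \<in> S" for v
    proof -
      have "map_poly \<sigma> [:snd v:] = [:\<sigma> (snd v):]"
        by (rule poly_eqI) (simp add: coeff_map_poly coeff_pCons split: nat.split)
      hence "map_poly \<sigma> (f v) = [:\<sigma> (snd v):] * (\<Prod>u\<in>U - {fst v}. map_poly \<sigma> [:- u, 1:])"
        unfolding f_def using prods[of "fst v"] \<sigma>.map_poly_mult[OF const] SL[OF v] by metis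
      also have "(\<Prod>u\<in>U - {fst v}. map_poly \<sigma> [:- u, 1:]) = (\<Prod>u\<in>U - {fst v}. [:- \<sigma> u, 1:])"
        by (intro prod.cong) (auto simp: map_poly_pCons \<sigma>.uminus UL)
      also have "\<dots> = (\<Prod>u\<in>U - {\<sigma> (fst v)}. [:- u, 1:])"
      proof (rule prod.reindex_bij_betw)
        show "bij_betw \<sigma> (U - {fst v}) (U - {\<sigma> (fst v)})"
          using bij_betw_DiffI[OF \<sigma>_U, of "{fst v}" "{\<sigma> (fst v)}"] SL[OF v] bij_betw_apply[OF \<sigma>_U]
          by (simp add: bij_betw_def)
      qed
      finally show ?thesis by (simp add: f_def)
    qed
    have "map_poly \<sigma> h = (\<Sum>v\<in>S. map_poly \<sigma> (f v)) \<and> (\<forall>i. coeff h i \<in> L)"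
      unfolding h_def by (rule \<sigma>.map_poly_sum) (rule f_mem)
    moreover have "(\<Sum>v\<in>S. map_poly \<sigma> (f v)) = (\<Sum>v\<in>S. f (?\<sigma> v))"
      by (rule sum.cong[OF refl mapf])
    moreover have "\<dots> = h" unfolding h_def by (rule sum.reindex_bij_betw[OF \<sigma>_S])
    ultimately show ?thesis by simp
  qed
  have coeff_K: "coeff h i \<in> K" for i
  proof (rule fixed_imp_base)
    show "coeff h i \<in> L" using inv[OF Gal.one_closed] by blast
    show "\<sigma> (coeff h i) = coeff h i" if "\<sigma> \<in> G" for \<sigma>
      using inv[OF that] field_automorphism.zero[OF Gal_automorphism[OF that]] by (metis coeff_map_poly)
  qed
  have tU: "(t, z) \<in> S"
    unfolding S_def using Gal.one_closed Gal_one[OF t] Gal_one[OF z] by (intro image_eqI[of _ _ "\<one>\<^bsub>gal_group L K\<^esub>"]) auto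
  \<comment> \<open>Summands with another first coordinate contain the factor \<open>t - t\<close>,
    and \<open>stab\<close> leaves \<open>(t, z)\<close> as the only point above
    \<open>t\<close>.\<close>
  have "poly (f v) t = (if v = (t, z) then z * (\<Prod>u\<in>U - {t}. t - u) else 0)" if v: "v \<in> S" for v
  proof (cases "fst v = t")
    case True
    moreover obtain \<sigma> where "\<sigma> \<in> G" "v = (\<sigma> t, \<sigma> z)" using v by (auto simp: S_def)
    ultimately have "v = (t, z)" using stab[of \<sigma>] by simp
    thus ?thesis by (simp add: f_def poly_prod)
  next
    case False
    moreover have "t \<in> U" using SL[OF tU] by simp
    ultimately show ?thesis using fin(1) by (auto simp: f_def poly_prod)
  qed
  hence "poly h t = (\<Sum>v\<in>S. if v = (t, z) then z * (\<Prod>u\<in>U - {t}. t - u) else 0)"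
    unfolding h_def poly_sum by (intro sum.cong) auto
  also have "\<dots> = z * (\<Prod>u\<in>U - {t}. t - u)" using fin(2) tU by (simp add: sum.delta)
  finally have "z * (\<Prod>u\<in>U - {t}. t - u) = poly h t" by simp
  moreover have "poly h t \<in> adjoin K {t}"
  proof -
    interpret A: field_subset "adjoin K {t}" by (rule field_subset_adjoin)
    show ?thesis unfolding poly_altdef
      using coeff_K adjoin_superset(1)[of K "{t}"] adjoin_superset(2)[of "{t}" K] by (intro A.sum_closed A.closed A.power_closed) auto
  qed
  ultimately show ?thesis by (simp add: U_def)
qed

text \<open>Interpolation for \<open>z\<close> and for 1 puts \<open>z * D\<close> and
  \<open>D\<close> into \<open>K(t)\<close>, where \<open>D\<close> is a product of nonzero
  differences. Their quotient is \<open>z\<close>.\<close>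

lemma mem_adjoin_if_stabilizer_subset:
  assumes t: "t \<in> L" and z: "z \<in> L" and stab: "\<And>\<sigma>. \<sigma> \<in> G \<Longrightarrow> \<sigma> t = t \<Longrightarrow> \<sigma> z = z"
  shows "z \<in> adjoin K {t}"
proof -
  interpret A: field_subset "adjoin K {t}" by (rule field_subset_adjoin)
  define D where "D = (\<Prod>u\<in>(\<lambda>\<sigma>. \<sigma> t) ` G - {t}. t - u)"
  have "D \<noteq> 0" unfolding D_def using orbit_finite[OF t] by auto
  have "z * D \<in> adjoin K {t}" "1 * D \<in> adjoin K {t}"
    unfolding D_def by (rule interpolation_mem; use t z stab field_automorphism.one[OF Gal_automorphism] in simp)+
  hence "(z * D) / (1 * D) \<in> adjoin K {t}" by (rule A.closed_derived)
  thus ?thesis using \<open>D \<noteq> 0\<close> by simp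
qed

lemma adjoin_subset_top: "t \<in> L \<Longrightarrow> adjoin K {t} \<subseteq> L"
  by (rule adjoin_least[OF subfield_L]) (auto simp: K_subset)

lemma Gal_adjoin_fixes:
  assumes "\<sigma> \<in> G" "t \<in> L" "\<sigma> t = t" "z \<in> adjoin K {t}"
  shows "\<sigma> z = z"
proof -
  interpret \<sigma>: field_automorphism L \<sigma> by (rule Gal_automorphism[OF assms(1)])
  have "z \<in> L \<and> \<sigma> z = z"
    using assms(4) unfolding adjoin_def
  proof (induction rule: generate_field.induct)
    case (incl h)
    thus ?case using assms K_subset Gal_fixes by auto
  next
    case (m_inv h)
    thus ?case by (simp add: \<sigma>.inverse)
  qed (simp_all add: \<sigma>.add \<sigma>.mult \<sigma>.uminus)
  thus ?thesis by simp
qed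

text \<open>Commutativity enters here: an automorphism fixing \<open>t\<close> fixes every
  \<open>z\<close> in \<open>K(t)\<close>, hence also \<open>\<rho> z\<close>, which therefore lies
  in \<open>K(t)\<close> again. Inverse automorphisms give the other inclusion.\<close>

lemma Gal_image_adjoin:
  assumes \<sigma>: "\<sigma> \<in> G" and t: "t \<in> L"
  shows "\<sigma> ` adjoin K {t} = adjoin K {t}"
proof -
  have sub: "\<rho> z \<in> adjoin K {t}" if \<rho>: "\<rho> \<in> G" and z: "z \<in> adjoin K {t}" for \<rho> z
  proof (rule mem_adjoin_if_stabilizer_subset[OF t])
    have zL: "z \<in> L" using z adjoin_subset_top[OF t] by blast
    thus "\<rho> z \<in> L" using field_automorphism.image_mem[OF Gal_automorphism[OF \<rho>]] by blast
    show "\<tau> (\<rho> z) = \<rho> z" if "\<tau> \<in> G" "\<tau> t = t" for \<tau>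
      using Gal_commute[OF that(1) \<rho> zL] Gal_adjoin_fixes[OF that(1) t that(2) z] by simp
  qed
  show ?thesis
  proof (intro equalityI subsetI)
    fix z assume z: "z \<in> adjoin K {t}"
    let ?r = "inv\<^bsub>gal_group L K\<^esub> \<sigma>"
    have r: "?r \<in> G" using \<sigma> by simp
    have zL: "z \<in> L" using z adjoin_subset_top[OF t] by blast
    have "z = \<sigma> (?r z)"
      using Gal_mult[OF \<sigma> r zL] Gal_one[OF zL] Gal.r_inv[OF \<sigma>] by simp
    thus "z \<in> \<sigma> ` adjoin K {t}" using sub[OF r z] by (rule image_eqI)
  next
    fix w assume "w \<in> \<sigma> ` adjoin K {t}"
    then obtain z where "z \<in> adjoin K {t}" "w = \<sigma> z" by (elim imageE)
    thus "w \<in> adjoin K {t}" using sub[OF \<sigma>] by simp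
  qed
qed

end

section \<open>The generator\<close>

text \<open>Otherwise \<open>x + x\<close> would equal \<open>b / a * (z - 1)\<close> with
  \<open>z = - 1\<close>, which is not an algebraic integer.\<close>

lemma nonzero_if_algebraic_int:
  fixes x :: "'a::field_char_0" and a b :: int
  assumes "algebraic_int x" "b \<noteq> 0" "2 * \<bar>b\<bar> < \<bar>a\<bar>"
  shows "of_int a * x + of_int b \<noteq> 0"
proof
  assume "of_int a * x + of_int b = 0"
  hence "x = - of_int b / of_int a"
    using assms(2,3) by (auto simp: field_simps eq_neg_iff_add_eq_0)
  hence "x + x = of_int b / of_int a * (- 1 - 1)" by simp
  thus False
    using algebraic_int_plus_times(1)[OF assms(1,1)]
      not_algebraic_int_root_of_unity_minus_1[of "- 1 :: 'a" 2 b a] assms(2,3) by simp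
qed

text \<open>The common core of the arguments for \<open>x\<close> and for \<open>y\<close>: the
  ratio \<open>s u / u\<close> is a root of unity, and an integrality argument shows that it is
  1.\<close>

lemma fixed_if_power_fixed:
  fixes L :: "'a::field_char_0 set" and a b n :: int
  assumes "field_automorphism L s" "x \<in> L" "algebraic_int x" and ab: "b \<noteq> 0" "2 * \<bar>b\<bar> < \<bar>a\<bar>"
    and u: "u = of_int a * x + of_int b"
    and eq: "(s u powi n) ^ l = (u powi n) ^ l" and "n \<noteq> 0" "l > 0"
  shows "s x = x"
proof -
  interpret field_automorphism L s by fact
  have "u \<noteq> 0" using nonzero_if_algebraic_int[OF assms(3) ab] u by simp
  have su: "s u = of_int a * s x + of_int b"
    using \<open>x \<in> L\<close> unfolding u by (simp add: add mult)
  define z where "z = s u / u"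
  have "(z powi n) ^ l = 1"
    using eq \<open>u \<noteq> 0\<close> by (simp add: z_def power_int_divide_distrib power_divide)
  \<comment> \<open>A negative \<open>n\<close> is handled by inverting, hence the absolute value in
    the exponent.\<close>
  hence zN: "z ^ (nat \<bar>n\<bar> * l) = 1"
    by (cases "n \<ge> 0") (simp_all add: power_int_def power_mult power_inverse)
  have "z = 1"
  proof (rule ccontr)
    assume "z \<noteq> 1"
    obtain p where "lead_coeff p = 1" "\<forall>i. coeff p i \<in> \<int>" "poly p x = 0"
      using \<open>algebraic_int x\<close> by (auto elim: algebraic_int.cases)
    \<comment> \<open>Integers are fixed by \<open>s\<close>, so \<open>s x\<close> is a root of the
      same monic polynomial as \<open>x\<close>.\<close>
    moreover have "c \<in> L \<and> s c = c" if "c \<in> \<int>" for c using that by (auto elim!: Ints_cases)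
    ultimately have "algebraic_int (s x)"
      using poly_root[of p x] \<open>x \<in> L\<close> by (intro algebraic_int.intros[of p]) simp_all
    moreover have "algebraic_int z"
      using algebraic_int_root_of_unity[OF zN] \<open>n \<noteq> 0\<close> \<open>l > 0\<close> by simp
    ultimately have "algebraic_int (s x + - (z * x))"
      using \<open>algebraic_int x\<close> by (intro algebraic_int_plus_times algebraic_int_minus)
    moreover have "s x + - (z * x) = of_int b / of_int a * (z - 1)"
    proof -
      have "s u = z * u" using \<open>u \<noteq> 0\<close> by (simp add: z_def)
      hence "of_int a * s x + of_int b = z * (of_int a * x + of_int b)"
        unfolding su unfolding u .
      hence "of_int a * (s x + - (z * x)) = of_int b * (z - 1)"
        by (simp add: algebra_simps)
      moreover have "of_int a \<noteq> (0 :: 'a)" using ab by auto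
      ultimately show ?thesis by (simp add: field_simps)
    qed
    ultimately show False
      using not_algebraic_int_root_of_unity_minus_1[OF zN _ \<open>z \<noteq> 1\<close> ab] \<open>n \<noteq> 0\<close> \<open>l > 0\<close> by simp
  qed
  hence "s u = u" using \<open>u \<noteq> 0\<close> by (simp add: z_def)
  hence "of_int a * s x + of_int b = of_int a * x + of_int b" unfolding su unfolding u .
  moreover have "of_int a \<noteq> (0 :: 'a)" using ab by auto
  ultimately show ?thesis by simp
qed

theorem theorem8p4:
  fixes K L :: "'a::field_char_0 set" and x y :: 'a
    and a b c d n m :: int and l :: nat
  assumes "number_field K"
    and "abelian_extension L K"
    and "algebraic_int x" and "algebraic_int y"
    and "L = adjoin K {x, y}"
    and "l = degree_ext L (adjoin K {x})"
    and "a \<noteq> 0" and "b \<noteq> 0" and "c \<noteq> 0" and "d \<noteq> 0"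
    and "2 < \<bar>real_of_int a / real_of_int b\<bar>"
    and "2 < \<bar>real_of_int c / real_of_int d\<bar>"
    and "n \<noteq> 0" and "m \<noteq> 0"
  shows "L = adjoin K {(of_int a * x + of_int b) powi n
                       * (of_int c * y + of_int d) powi (- (m * int l))
                       * field_norm L (adjoin K {x}) ((of_int c * y + of_int d) powi m)}"
proof -
  interpret abelian_field_extension K L by unfold_locales fact
  define F where "F = adjoin K {x}"
  define u where "u = of_int a * x + of_int b"
  define v where "v = of_int c * y + of_int d"
  define e where "e = v powi m"
  define N where "N = field_norm L F"
  define w where "w = u powi n * v powi (- (m * int l)) * N e"
  have xy: "x \<in> L" "y \<in> L" using adjoin_superset(2)[of "{x, y}" K] assms(5) by auto
  have ab: "2 * \<bar>b\<bar> < \<bar>a\<bar>" and cd: "2 * \<bar>d\<bar> < \<bar>c\<bar>"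
  proof -
    have "2 * \<bar>q\<bar> < \<bar>p\<bar>" if "2 < \<bar>real_of_int p / real_of_int q\<bar>" "q \<noteq> 0" for p q :: int
    proof -
      have "2 * \<bar>real_of_int q\<bar> < \<bar>real_of_int p\<bar>"
        using that by (simp add: abs_divide pos_less_divide_eq)
      thus ?thesis by linarith
    qed
    thus "2 * \<bar>b\<bar> < \<bar>a\<bar>" "2 * \<bar>d\<bar> < \<bar>c\<bar>" using assms(8,10-12) by blast+
  qed
  have "(ring.algebraic amb over K) y"
    using galois xy by (auto simp: galois_extension_def)
  hence ext: "finite_field_extension F L"
    unfolding F_def assms(5) by (rule finite_field_extension_adjoin[OF subfield_K])
  interpret ext: finite_field_extension F L by (rule ext)
  have l: "l = degree_ext L F" "l > 0" using assms(6) ext.degree_pos by (simp_all add: F_def)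
  have FL: "z \<in> L" if "z \<in> F" for z using ext.subset that by blast
  have xF: "x \<in> F" using adjoin_superset(2)[of "{x}" K] by (simp add: F_def)
  have uF: "u \<in> F" using xF by (simp add: u_def)
  have vL: "v \<in> L" using xy by (simp add: v_def)
  have "v \<noteq> 0" unfolding v_def by (rule nonzero_if_algebraic_int) fact+
  hence e: "e \<in> L" "e \<noteq> 0" using vL by (simp_all add: e_def)
  have NF: "N e \<in> F" unfolding N_def by (rule ext.norm_closed[OF e(1)])
  \<comment> \<open>In this form the norm of the factor is \<open>N (inverse e) ^ l\<close>, which
    cancels against \<open>N (N e) = N e ^ l\<close>; the latter holds because \<open>N e\<close>
    lies in \<open>F\<close>.\<close>
  have v_pow: "v powi (- (m * int l)) = inverse e ^ l"
    by (simp add: e_def power_int_minus power_int_mult power_inverse)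
  have wL: "w \<in> L"
    unfolding w_def v_pow using uF NF e FL by simp
  have Nw: "N w = (u powi n) ^ l"
  proof -
    have "N w = N (u powi n) * N (inverse e ^ l) * N (N e)"
      unfolding w_def v_pow N_def using uF NF[unfolded N_def] e FL by (simp add: ext.norm_mult)
    also have "N (N e) = N e ^ l"
      using NF ext.norm_scalar[of "N e"] by (simp add: N_def l)
    also have "N (u powi n) = (u powi n) ^ l"
      using uF ext.norm_scalar[of "u powi n"] by (simp add: N_def l)
    also have "N (inverse e ^ l) = N (inverse e) ^ l"
      using e ext.norm_power by (simp add: N_def)
    also have "(u powi n) ^ l * N (inverse e) ^ l * N e ^ l = (u powi n) ^ l * (N (inverse e * e)) ^ l"
      using e ext.norm_mult[of "inverse e" e] by (simp only: N_def top.inverse_closed power_mult_distrib mult.assoc)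
    finally show ?thesis using e(2) ext.norm_one by (simp add: N_def)
  qed
  have fixed: "\<sigma> x = x \<and> \<sigma> y = y" if \<sigma>: "\<sigma> \<in> G" and \<sigma>w: "\<sigma> w = w" for \<sigma>
  proof -
    interpret \<sigma>: field_automorphism L \<sigma> by (rule Gal_automorphism[OF \<sigma>])
    \<comment> \<open>\<open>F\<close> is stable although \<open>\<sigma>\<close> is not yet known
      to fix \<open>x\<close>, so the norm to \<open>F\<close> already commutes with
      \<open>\<sigma>\<close>.\<close>
    have "\<sigma> ` F = F" unfolding F_def by (rule Gal_image_adjoin[OF \<sigma> xy(1)])
    hence "N (\<sigma> w) = \<sigma> (N w)" unfolding N_def by (rule \<sigma>.field_norm[OF ext _ wL])
    hence "(\<sigma> u powi n) ^ l = (u powi n) ^ l"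
      using FL[OF uF] by (simp add: \<sigma>w Nw \<sigma>.power \<sigma>.power_int)
    hence \<sigma>x: "\<sigma> x = x"
      using fixed_if_power_fixed[OF \<sigma>.field_automorphism_axioms xy(1) assms(3,8) ab u_def] assms(13) l(2)
      by blast
    have \<sigma>F: "\<sigma> z = z" if "z \<in> F" for z
      using Gal_adjoin_fixes[OF \<sigma> xy(1) \<sigma>x] that by (simp add: F_def)
    have "u \<noteq> 0" unfolding u_def by (rule nonzero_if_algebraic_int) fact+
    \<comment> \<open>\<open>e\<close> is invertible and the norm is multiplicative.\<close>
    have "N e \<noteq> 0"
    proof
      assume "N e = 0"
      hence "N (inverse e * e) = 0"
        using ext.norm_mult[of "inverse e" e] e(1) by (simp add: N_def)
      thus False using e(2) ext.norm_one by (simp add: N_def)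
    qed
    \<comment> \<open>Now \<open>\<sigma>\<close> is the identity on \<open>F\<close>, so
      \<open>u powi n\<close> and \<open>N e\<close> cancel from \<open>\<sigma> w = w\<close> and
      only the power of \<open>e\<close> remains.\<close>
    have "\<sigma> w = u powi n * \<sigma> (inverse e ^ l) * N e"
      unfolding w_def v_pow using uF NF e FL
      by (simp add: \<sigma>.mult \<sigma>F)
    hence "\<sigma> (inverse e ^ l) = inverse e ^ l"
      using \<sigma>w \<open>u \<noteq> 0\<close> \<open>N e \<noteq> 0\<close> unfolding w_def v_pow by simp
    hence "\<sigma> e ^ l = e ^ l"
      using e by (simp add: \<sigma>.power \<sigma>.inverse power_inverse)
    hence "(\<sigma> v powi m) ^ l = (v powi m) ^ l"
      using vL by (simp add: e_def \<sigma>.power_int)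
    hence "\<sigma> y = y"
      using fixed_if_power_fixed[OF \<sigma>.field_automorphism_axioms xy(2) assms(4,10) cd v_def] assms(14) l(2)
      by blast
    with \<sigma>x show ?thesis by blast
  qed
  have "x \<in> adjoin K {w}" "y \<in> adjoin K {w}"
    by (rule mem_adjoin_if_stabilizer_subset[OF wL]; use xy fixed in blast)+
  hence "L \<subseteq> adjoin K {w}"
    unfolding assms(5) using field_subset.subfield[OF field_subset_adjoin]
    by (intro adjoin_least adjoin_superset) auto
  moreover have "adjoin K {w} \<subseteq> L" by (rule adjoin_subset_top[OF wL])
  ultimately have "L = adjoin K {w}" by (rule subset_antisym)
  thus ?thesis unfolding w_def N_def e_def u_def v_def F_def .
qed

end
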